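(* Let $N\ge 1$, $d\ge 2$, $m>0$, $\gamma>0$, $\kappa\ge 0$, $T>0$. Let $\mathbf{u}=(u_1,\dots,u_N)$ with $u_i\in L^2([0,T];\mathbb R^d)$ and set $M:=\max_{i\in[N]}\|u_i\|_{L^2([0,T];\mathbb R^d)}$. Let initial data $x_i^0\in\mathbb S^{d-1}$ and $v_i^0\in T_{x_i^0}\mathbb S^{d-1}$ (i.e. $\langle x_i^0,v_i^0\rangle=0$), $i\in[N]$, be given, and set $\mathcal V(0):=\max_{i\in[N]}\|v_i^0\|$. Assume $$\frac{m}{\gamma}\Big(\mathcal V(0)+\frac{2\kappa T}{m}+2MT^{1/2}\Big)\Big(\exp\Big(\frac{\gamma T}{m}\Big)-1\Big)<1.$$ Then there exists a unique global (absolutely continuous) solution $\{(x_i,v_i)\}_{i=1}^N$ on $[0,T]$ of the controlled system $$\begin{cases}\dot x_i=v_i,\\ \dot v_i=-\dfrac{\|v_i\|^2}{\|x_i\|^2}x_i-\dfrac{\gamma}{m}v_i+\dfrac{\kappa}{mN}\displaystyle\sum_{j=1}^N\Big(x_j-\frac{\langle x_i,x_j\rangle}{\|x_i\|^2}x_i\Big)+\Big(u_i-\frac{\langle u_i,x_i\rangle}{\|x_i\|^2}x_i\Big),\\ x_i(0)=x_i^0,\quad v_i(0)=v_i^0,\qquad i\in[N].\end{cases}$$ Moreover, for all $i\in[N]$ and $t\in[0,T]$, $\|x_i(t)\|=1$ and $\langle x_i(t),v_i(t)\rangle=0$, and with $\mathcal V(t):=\max_{i\in[N]}\|v_i(t)\|$,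 $$\sup_{t\in[0,T]}\mathcal V(t)\le \frac{\exp\big(\frac{\gamma T}{m}\big)\Big(\mathcal V(0)+\frac{2\kappa T}{m}+2MT^{1/2}\Big)}{1-\frac{m}{\gamma}\Big(\mathcal V(0)+\frac{2\kappa T}{m}+2MT^{1/2}\Big)\Big(\exp\big(\frac{\gamma T}{m}\big)-1\Big)}=:C_V.$$
   Context: $[N]:=\{1,\dots,N\}$; $\|\cdot\|$ and $\langle\cdot,\cdot\rangle$ denote the Euclidean norm and inner product on $\mathbb R^d$; $\mathbb S^{d-1}$ is the unit sphere in $\mathbb R^d$ and $T_x\mathbb S^{d-1}=\{v\in\mathbb R^d:\langle x,v\rangle=0\}$. Solutions are understood in the Carathéodory sense (absolutely continuous, equations holding a.e.), since the controls are only $L^2$ in time. *)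

theory Defs
  imports "HOL-Analysis.Analysis"
begin

definition abs_continuous_on :: "real \<Rightarrow> real \<Rightarrow> (real \<Rightarrow> 'a::real_normed_vector) \<Rightarrow> bool" where
  "abs_continuous_on a b f \<longleftrightarrow>
    (\<forall>\<epsilon>>0. \<exists>\<delta>>0. \<forall>(n::nat) (I::nat \<Rightarrow> real \<times> real).
       (\<forall>k<n. a \<le> fst (I k) \<and> fst (I k) \<le> snd (I k) \<and> snd (I k) \<le> b) \<and>
       (\<forall>k<n. \<forall>l<n. k \<noteq> l \<longrightarrow> snd (I k) \<le> fst (I l) \<or> snd (I l) \<le> fst (I k)) \<and>
       (\<Sum>k<n. snd (I k) - fst (I k)) < \<delta>
       \<longrightarrow> (\<Sum>k<n. norm (f (snd (I k)) - f (fst (I k)))) < \<epsilon>)"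

definition vel_rhs ::
  "real \<Rightarrow> real \<Rightarrow> real \<Rightarrow> nat \<Rightarrow> (nat \<Rightarrow> real \<Rightarrow> 'a::euclidean_space)
   \<Rightarrow> (nat \<Rightarrow> real \<Rightarrow> 'a) \<Rightarrow> (nat \<Rightarrow> real \<Rightarrow> 'a) \<Rightarrow> nat \<Rightarrow> real \<Rightarrow> 'a" where
  "vel_rhs m \<gamma> \<kappa> N u x v i t =
     - ((norm (v i t))\<^sup>2 / (norm (x i t))\<^sup>2) *\<^sub>R x i t
     - (\<gamma> / m) *\<^sub>R v i t
     + (\<kappa> / (m * real N)) *\<^sub>R (\<Sum>j\<in>{1..N}. x j t - ((x i t \<bullet> x j t) / (norm (x i t))\<^sup>2) *\<^sub>R x i t)
     + (u i t - ((u i t \<bullet> x i t) / (norm (x i t))\<^sup>2) *\<^sub>R x i t)"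

text \<open>Caratheodory solution on [0,T]: x_i, v_i absolutely continuous, x_i nonvanishing
  (so that the right-hand side is defined), ODEs hold for a.e. t in [0,T],
  initial conditions hold.\<close>
definition is_solution ::
  "real \<Rightarrow> real \<Rightarrow> real \<Rightarrow> nat \<Rightarrow> real \<Rightarrow> (nat \<Rightarrow> real \<Rightarrow> 'a::euclidean_space)
   \<Rightarrow> (nat \<Rightarrow> 'a) \<Rightarrow> (nat \<Rightarrow> 'a) \<Rightarrow> (nat \<Rightarrow> real \<Rightarrow> 'a) \<Rightarrow> (nat \<Rightarrow> real \<Rightarrow> 'a) \<Rightarrow> bool" where
  "is_solution m \<gamma> \<kappa> N T u x0 v0 x v \<longleftrightarrow>
     (\<forall>i\<in>{1..N}.
        abs_continuous_on 0 T (x i) \<and> abs_continuous_on 0 T (v i) \<and>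
        x i 0 = x0 i \<and> v i 0 = v0 i \<and>
        (\<forall>t\<in>{0..T}. x i t \<noteq> 0) \<and>
        (AE t in lborel. t \<in> {0..T} \<longrightarrow>
            (x i has_vector_derivative v i t) (at t) \<and>
            (v i has_vector_derivative vel_rhs m \<gamma> \<kappa> N u x v i t) (at t)))"

definition L2_norm_on :: "real \<Rightarrow> (real \<Rightarrow> 'a::euclidean_space) \<Rightarrow> real" where
  "L2_norm_on T f = sqrt (LINT t:{0..T}|lborel. (norm (f t))\<^sup>2)"

end

theory Submission
  imports Defs
begin

text \<open>
  Any solution stays on the sphere: \<open>b = \<langle>x\<^sub>i, v\<^sub>i\<rangle>\<close> satisfies \<open>b' = - (\<gamma> / m) b\<close> with \<open>b(0) = 0\<close>, hence
  vanishes, and then \<open>\<parallel>x\<^sub>i\<parallel>\<^sup>2\<close> is constant. On the sphere the normal terms drop out of \<open>\<langle>v\<^sub>i, v\<^sub>i'\<rangle>\<close>, so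
  \<open>(\<parallel>v\<^sub>i\<parallel>\<^sup>2)' \<le> 2 \<parallel>v\<^sub>i\<parallel> (\<kappa> / m + \<parallel>u\<^sub>i\<parallel>)\<close>; evaluating at the maximum of \<open>\<parallel>v\<^sub>i\<parallel>\<close> gives the bound
  \<open>\<parallel>v\<^sub>i\<parallel> \<le> A\<close>, where \<open>A\<close> is the bracket \<open>V(0) + 2\<kappa>T/m + 2MT\<^sup>1\<^sup>/\<^sup>2\<close> of the statement, and \<open>A \<le> C\<^sub>V\<close>.
  For existence the right-hand side is truncated so that it becomes globally Lipschitz with an
  integrable constant \<open>L(t)\<close>; the Picard map is then a contraction for the norm weighted by
  \<open>exp (- 2 \<integral>\<^sub>0\<^sup>t L)\<close>. By the a priori bounds the truncation is never active, neither for the fixed point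
  (look at the first time it would be) nor for any other solution, which also gives uniqueness.
  The Caratheodory sense requires two facts on absolutely continuous functions: they are the integral
  of their a.e. derivative, and indefinite integrals are a.e. differentiable.
\<close>

section \<open>Absolutely continuous functions\<close>

text \<open>Completing a measure does not change which properties hold almost everywhere. This
  translates the a.e. clauses of the solution concept into the null sets used by the gauge
  integral.\<close>

lemma AE_lborel_iff_negligible: "(AE t in lborel. P t) \<longleftrightarrow> negligible {t. \<not> P t}"
proof -
  have "(AE t in lborel. P t) \<longleftrightarrow> (AE t in lebesgue. P t)"
    by (rule AE_completion_iff[symmetric])
  also have "\<dots> \<longleftrightarrow> negligible {t. \<not> P t}"
    by (simp add: completion.AE_iff_null_sets negligible_iff_null_sets eventually_ae_filter)
       (metis (no_types, lifting) completion.complete2 order_refl)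
  finally show ?thesis .
qed

lemma abs_continuous_onE:
  fixes f :: "real \<Rightarrow> 'a::real_normed_vector"
  assumes "abs_continuous_on a b f" "e > 0"
  obtains d where "d > 0"
    "\<And>(n::nat) I. \<lbrakk>\<forall>k<n. a \<le> fst (I k) \<and> fst (I k) \<le> snd (I k) \<and> snd (I k) \<le> b;
       \<forall>k<n. \<forall>l<n. k \<noteq> l \<longrightarrow> snd (I k) \<le> fst (I l) \<or> snd (I l) \<le> fst (I k);
       (\<Sum>k<n. snd (I k) - fst (I k)) < d\<rbrakk>
       \<Longrightarrow> (\<Sum>k<n. norm (f (snd (I k)) - f (fst (I k)))) < e"
proof -
  from abs_continuous_on_def[THEN iffD1, THEN spec, THEN mp, OF assms]
  obtain d where d: "d > 0" and D: "\<forall>(n::nat) I.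
      (\<forall>k<n. a \<le> fst (I k) \<and> fst (I k) \<le> snd (I k) \<and> snd (I k) \<le> b) \<and>
      (\<forall>k<n. \<forall>l<n. k \<noteq> l \<longrightarrow> snd (I k) \<le> fst (I l) \<or> snd (I l) \<le> fst (I k)) \<and>
      (\<Sum>k<n. snd (I k) - fst (I k)) < d
       \<longrightarrow> (\<Sum>k<n. norm (f (snd (I k)) - f (fst (I k)))) < e" by (elim exE conjE)
  show thesis
    by (rule that[OF d]) (rule D[THEN spec, THEN spec, THEN mp, OF conjI[OF _ conjI]])
qed

text \<open>Enumerating the finite index set reduces this to the definition. It lets tagged
  intervals of a division serve directly as indices.\<close>

lemma abs_continuous_on_finite_family:
  fixes f :: "real \<Rightarrow> 'a::real_normed_vector"
  assumes "abs_continuous_on a b f" "e > 0"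
  obtains d where "d > 0"
    "\<And>(K::'k set) l r. \<lbrakk>finite K; \<And>k. k \<in> K \<Longrightarrow> a \<le> l k \<and> l k \<le> r k \<and> r k \<le> b;
       \<And>k j. \<lbrakk>k \<in> K; j \<in> K; k \<noteq> j\<rbrakk> \<Longrightarrow> r k \<le> l j \<or> r j \<le> l k; (\<Sum>k\<in>K. r k - l k) < d\<rbrakk>
      \<Longrightarrow> (\<Sum>k\<in>K. norm (f (r k) - f (l k))) < e"
proof -
  obtain d where d: "d > 0" and D: "\<And>n I. \<lbrakk>\<forall>k<n. a \<le> fst (I k) \<and> fst (I k) \<le> snd (I k) \<and> snd (I k) \<le> b;
       \<forall>k<n. \<forall>l<n. k \<noteq> l \<longrightarrow> snd (I k) \<le> fst (I l) \<or> snd (I l) \<le> fst (I k);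
       (\<Sum>k<n. snd (I k) - fst (I k)) < d\<rbrakk>
       \<Longrightarrow> (\<Sum>k<(n::nat). norm (f (snd (I k)) - f (fst (I k)))) < e"
    using abs_continuous_onE[OF assms] by blast
  show thesis
  proof (rule that[OF d])
    fix K :: "'k set" and l r
    assume K: "finite K" "\<And>k. k \<in> K \<Longrightarrow> a \<le> l k \<and> l k \<le> r k \<and> r k \<le> b"
       "\<And>k j. \<lbrakk>k \<in> K; j \<in> K; k \<noteq> j\<rbrakk> \<Longrightarrow> r k \<le> l j \<or> r j \<le> l k" "(\<Sum>k\<in>K. r k - l k) < d"
    obtain h where h: "bij_betw h {..<card K} K"
      using ex_bij_betw_nat_finite[OF K(1)] by (auto simp: atLeast0LessThan)
    have hK: "h k \<in> K" if "k < card K" for k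
      using h that by (auto simp: bij_betw_def)
    have hinj: "h k \<noteq> h j" if "k < card K" "j < card K" "k \<noteq> j" for k j
      using h that by (auto simp: bij_betw_def inj_on_def)
    have "(\<Sum>k<card K. norm (f (snd (l (h k), r (h k))) - f (fst (l (h k), r (h k))))) < e"
    proof (rule D)
      show "(\<Sum>k<card K. snd (l (h k), r (h k)) - fst (l (h k), r (h k))) < d"
        using K(4) sum.reindex_bij_betw[OF h, of "\<lambda>k. r k - l k"] by simp
    qed (use K hK hinj in auto)
    then show "(\<Sum>k\<in>K. norm (f (r k) - f (l k))) < e"
      using sum.reindex_bij_betw[OF h, of "\<lambda>k. norm (f (r k) - f (l k))"] by simp
  qed
qed

lemma abs_continuous_on_subinterval:
  assumes "abs_continuous_on a b f" "a \<le> c" "d \<le> b"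
  shows "abs_continuous_on c d f"
  unfolding abs_continuous_on_def
proof (intro allI impI)
  fix e :: real assume "e > 0"
  then obtain \<delta> where "\<delta> > 0" and D: "\<And>n I. \<lbrakk>\<forall>k<n. a \<le> fst (I k) \<and> fst (I k) \<le> snd (I k) \<and> snd (I k) \<le> b;
       \<forall>k<n. \<forall>l<n. k \<noteq> l \<longrightarrow> snd (I k) \<le> fst (I l) \<or> snd (I l) \<le> fst (I k);
       (\<Sum>k<n. snd (I k) - fst (I k)) < \<delta>\<rbrakk>
       \<Longrightarrow> (\<Sum>k<(n::nat). norm (f (snd (I k)) - f (fst (I k)))) < e"
    using abs_continuous_onE[OF assms(1) \<open>e > 0\<close>] by blast
  show "\<exists>\<delta>>0. \<forall>(n::nat) I. (\<forall>k<n. c \<le> fst (I k) \<and> fst (I k) \<le> snd (I k) \<and> snd (I k) \<le> d) \<and>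
               (\<forall>k<n. \<forall>l<n. k \<noteq> l \<longrightarrow> snd (I k) \<le> fst (I l) \<or> snd (I l) \<le> fst (I k)) \<and>
               (\<Sum>k<n. snd (I k) - fst (I k)) < \<delta> \<longrightarrow>
               (\<Sum>k<n. norm (f (snd (I k)) - f (fst (I k)))) < e"
  proof (intro exI[of _ \<delta>] conjI allI impI)
    fix n :: nat and I :: "nat \<Rightarrow> real \<times> real"
    assume A: "(\<forall>k<n. c \<le> fst (I k) \<and> fst (I k) \<le> snd (I k) \<and> snd (I k) \<le> d) \<and>
               (\<forall>k<n. \<forall>l<n. k \<noteq> l \<longrightarrow> snd (I k) \<le> fst (I l) \<or> snd (I l) \<le> fst (I k)) \<and>
               (\<Sum>k<n. snd (I k) - fst (I k)) < \<delta>"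
    show "(\<Sum>k<n. norm (f (snd (I k)) - f (fst (I k)))) < e"
      by (rule D) (use A assms(2,3) in \<open>auto intro: order_trans\<close>)
  qed fact
qed

text \<open>A single comparison principle from which products, exponentials of indefinite integrals
  and pairs inherit absolute continuity. Two comparison functions are allowed because the increment
  of a product involves both factors.\<close>

lemma abs_continuous_on_dominated:
  fixes f :: "real \<Rightarrow> 'a::real_normed_vector" and g :: "real \<Rightarrow> 'b::real_normed_vector"
    and h :: "real \<Rightarrow> 'c::real_normed_vector"
  assumes f: "abs_continuous_on a b f" and g: "abs_continuous_on a b g"
    and h: "\<And>s t. \<lbrakk>a \<le> s; s \<le> t; t \<le> b\<rbrakk> \<Longrightarrow> norm (h t - h s) \<le> C * (norm (f t - f s) + norm (g t - g s))"
  shows "abs_continuous_on a b h"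
  unfolding abs_continuous_on_def
proof (intro allI impI)
  fix e :: real assume e: "e > 0"
  \<comment> \<open>Replacing \<open>C\<close> by a positive number makes the tolerance
    \<open>e / (2 * D)\<close> meaningful whatever the sign of \<open>C\<close>.\<close>
  define D where "D = \<bar>C\<bar> + 1"
  have D: "D > 0" "C \<le> D" by (auto simp: D_def)
  have e': "e / (2 * D) > 0" using e D by simp
  obtain d1 where d1: "d1 > 0" and D1: "\<And>n I. \<lbrakk>\<forall>k<n. a \<le> fst (I k) \<and> fst (I k) \<le> snd (I k) \<and> snd (I k) \<le> b;
       \<forall>k<n. \<forall>l<n. k \<noteq> l \<longrightarrow> snd (I k) \<le> fst (I l) \<or> snd (I l) \<le> fst (I k);
       (\<Sum>k<n. snd (I k) - fst (I k)) < d1\<rbrakk>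
       \<Longrightarrow> (\<Sum>k<(n::nat). norm (f (snd (I k)) - f (fst (I k)))) < e / (2 * D)"
    using abs_continuous_onE[OF f e'] by blast
  obtain d2 where d2: "d2 > 0" and D2: "\<And>n I. \<lbrakk>\<forall>k<n. a \<le> fst (I k) \<and> fst (I k) \<le> snd (I k) \<and> snd (I k) \<le> b;
       \<forall>k<n. \<forall>l<n. k \<noteq> l \<longrightarrow> snd (I k) \<le> fst (I l) \<or> snd (I l) \<le> fst (I k);
       (\<Sum>k<n. snd (I k) - fst (I k)) < d2\<rbrakk>
       \<Longrightarrow> (\<Sum>k<(n::nat). norm (g (snd (I k)) - g (fst (I k)))) < e / (2 * D)"
    using abs_continuous_onE[OF g e'] by blast
  show "\<exists>\<delta>>0. \<forall>(n::nat) I. (\<forall>k<n. a \<le> fst (I k) \<and> fst (I k) \<le> snd (I k) \<and> snd (I k) \<le> b) \<and>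
               (\<forall>k<n. \<forall>l<n. k \<noteq> l \<longrightarrow> snd (I k) \<le> fst (I l) \<or> snd (I l) \<le> fst (I k)) \<and>
               (\<Sum>k<n. snd (I k) - fst (I k)) < \<delta> \<longrightarrow>
               (\<Sum>k<n. norm (h (snd (I k)) - h (fst (I k)))) < e"
  proof (intro exI[of _ "min d1 d2"] conjI allI impI)
    show "min d1 d2 > 0" using d1 d2 by simp
    fix n :: nat and I :: "nat \<Rightarrow> real \<times> real"
    assume A: "(\<forall>k<n. a \<le> fst (I k) \<and> fst (I k) \<le> snd (I k) \<and> snd (I k) \<le> b) \<and>
               (\<forall>k<n. \<forall>l<n. k \<noteq> l \<longrightarrow> snd (I k) \<le> fst (I l) \<or> snd (I l) \<le> fst (I k)) \<and>
               (\<Sum>k<n. snd (I k) - fst (I k)) < min d1 d2"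
    have F: "(\<Sum>k<n. norm (f (snd (I k)) - f (fst (I k)))) < e / (2 * D)"
      using A by (intro D1) auto
    have G: "(\<Sum>k<n. norm (g (snd (I k)) - g (fst (I k)))) < e / (2 * D)"
      using A by (intro D2) auto
    have "(\<Sum>k<n. norm (h (snd (I k)) - h (fst (I k))))
      \<le> (\<Sum>k<n. D * (norm (f (snd (I k)) - f (fst (I k))) + norm (g (snd (I k)) - g (fst (I k)))))"
    proof (rule sum_mono)
      fix k assume "k \<in> {..<n}"
      then have "norm (h (snd (I k)) - h (fst (I k)))
        \<le> C * (norm (f (snd (I k)) - f (fst (I k))) + norm (g (snd (I k)) - g (fst (I k))))"
        using A by (intro h) auto
      also have "\<dots> \<le> D * (norm (f (snd (I k)) - f (fst (I k))) + norm (g (snd (I k)) - g (fst (I k))))"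
        using D by (intro mult_right_mono) auto
      finally show "norm (h (snd (I k)) - h (fst (I k)))
        \<le> D * (norm (f (snd (I k)) - f (fst (I k))) + norm (g (snd (I k)) - g (fst (I k))))" .
    qed
    also have "\<dots> = D * ((\<Sum>k<n. norm (f (snd (I k)) - f (fst (I k)))) + (\<Sum>k<n. norm (g (snd (I k)) - g (fst (I k)))))"
      by (simp add: sum_distrib_left sum.distrib distrib_left)
    also have "\<dots> < D * (e / (2 * D) + e / (2 * D))"
      using F G D by (intro mult_strict_left_mono add_strict_mono)
    also have "\<dots> = e" using D by simp
    finally show "(\<Sum>k<n. norm (h (snd (I k)) - h (fst (I k)))) < e" .
  qed
qed

lemma abs_continuous_on_imp_continuous_on:
  fixes f :: "real \<Rightarrow> 'a::real_normed_vector"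
  assumes "abs_continuous_on a b f"
  shows "continuous_on {a..b} f"
  unfolding continuous_on_iff
proof (intro ballI allI impI)
  fix x e :: real assume x: "x \<in> {a..b}" and e: "e > 0"
  obtain d where d: "d > 0" and D: "\<And>(K::unit set) l r. \<lbrakk>finite K; \<And>k. k \<in> K \<Longrightarrow> a \<le> l k \<and> l k \<le> r k \<and> r k \<le> b;
       \<And>k j. \<lbrakk>k \<in> K; j \<in> K; k \<noteq> j\<rbrakk> \<Longrightarrow> r k \<le> l j \<or> r j \<le> l k; (\<Sum>k\<in>K. r k - l k) < d\<rbrakk>
      \<Longrightarrow> (\<Sum>k\<in>K. norm (f (r k) - f (l k))) < e"
    by (rule abs_continuous_on_finite_family[OF assms e, where 'k = unit]) blast
  have "dist (f y) (f x) < e" if "y \<in> {a..b}" "dist y x < d" for y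
    \<comment> \<open>A one-element family of intervals suffices; \<open>min\<close> and
      \<open>max\<close> put its endpoints in order.\<close>
    using D[of UNIV "\<lambda>_. min x y" "\<lambda>_. max x y"] that x
    by (cases "x \<le> y") (auto simp: dist_norm max_def min_def UNIV_unit norm_minus_commute)
  then show "\<exists>d>0. \<forall>x'\<in>{a..b}. dist x' x < d \<longrightarrow> dist (f x') (f x) < e"
    using d by blast
qed

text \<open>Both factors are bounded on the compact interval, and the increment of the product
  splits into two terms, each of which varies only one factor.\<close>

lemma abs_continuous_on_bilinear:
  fixes f :: "real \<Rightarrow> 'a::real_normed_vector" and g :: "real \<Rightarrow> 'b::real_normed_vector"
  assumes B: "bounded_bilinear B" and f: "abs_continuous_on a b f" and g: "abs_continuous_on a b g"
  shows "abs_continuous_on a b (\<lambda>t. B (f t) (g t))"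
proof -
  interpret bounded_bilinear B by fact
  obtain K where K: "K > 0" "\<And>x y. norm (B x y) \<le> norm x * norm y * K"
    using pos_bounded by blast
  have "compact (f ` {a..b})" "compact (g ` {a..b})"
    using abs_continuous_on_imp_continuous_on f g compact_continuous_image compact_Icc by blast+
  then have "bounded (f ` {a..b})" "bounded (g ` {a..b})"
    using compact_imp_bounded by blast+
  then obtain P Q where P: "P > 0" "\<And>t. t \<in> {a..b} \<Longrightarrow> norm (f t) \<le> P"
    and Q: "Q > 0" "\<And>t. t \<in> {a..b} \<Longrightarrow> norm (g t) \<le> Q"
    unfolding bounded_pos by (metis image_eqI)
  show ?thesis
  proof (rule abs_continuous_on_dominated[OF f g, where C = "(P + Q) * K"])
    fix s t assume st: "a \<le> s" "s \<le> t" "t \<le> b"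
    have "B (f t) (g t) - B (f s) (g s) = B (f t - f s) (g t) + B (f s) (g t - g s)"
      by (simp add: diff_left diff_right)
    then have "norm (B (f t) (g t) - B (f s) (g s)) \<le> norm (B (f t - f s) (g t)) + norm (B (f s) (g t - g s))"
      by (metis norm_triangle_ineq)
    also have "\<dots> \<le> norm (f t - f s) * norm (g t) * K + norm (f s) * norm (g t - g s) * K"
      by (intro add_mono K)
    also have "\<dots> \<le> norm (f t - f s) * (P + Q) * K + (P + Q) * norm (g t - g s) * K"
      using P(2)[of s] Q(2)[of t] st P(1) Q(1) K(1)
      by (intro add_mono mult_right_mono mult_left_mono) auto
    finally show "norm (B (f t) (g t) - B (f s) (g s)) \<le> (P + Q) * K * (norm (f t - f s) + norm (g t - g s))"
      by (simp add: algebra_simps)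
  qed
qed

section \<open>The fundamental theorem for absolutely continuous functions\<close>

text \<open>Integrability of \<open>g\<close> comes out of an explicit gauge. At a tag where the
  derivative exists, the gauge is so fine that the increment of \<open>f\<close> is close to
  derivative times length. At a tag in the exceptional null set, the interval is forced into an open
  set of small measure, and absolute continuity makes the total increment over such intervals
  small.\<close>

theorem abs_continuous_on_has_integral:
  fixes f :: "real \<Rightarrow> 'a::banach"
  assumes f: "abs_continuous_on a b f" and ab: "a \<le> b"
    and deriv: "AE t in lborel. t \<in> {a..b} \<longrightarrow> (f has_vector_derivative g t) (at t within {a..b})"
  shows "(g has_integral (f b - f a)) {a..b}"
proof (cases "a = b")
  case True then show ?thesis by (simp add: has_integral_refl)
next
  case False
  with ab have ab: "a < b" by simp
  define E where "E = {t. \<not> (t \<in> {a..b} \<longrightarrow> (f has_vector_derivative g t) (at t within {a..b}))}"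
  have E: "negligible E" using deriv unfolding AE_lborel_iff_negligible E_def .
  define h where "h t = (if t \<in> E then 0 else g t)" for t
  have "(h has_integral (f b - f a)) {a..b}"
    unfolding has_integral_factor_content_real
  proof (intro allI impI)
    fix e :: real assume e: "e > 0"
    \<comment> \<open>Half of the tolerance is reserved for the exceptional tags, the other half for
      the differentiable ones.\<close>
    then have "e / 2 * (b - a) > 0" using ab by simp
    then obtain d where d: "d > 0" and D: "\<And>(K::(real \<times> real set) set) l r. \<lbrakk>finite K; \<And>k. k \<in> K \<Longrightarrow> a \<le> l k \<and> l k \<le> r k \<and> r k \<le> b;
       \<And>k j. \<lbrakk>k \<in> K; j \<in> K; k \<noteq> j\<rbrakk> \<Longrightarrow> r k \<le> l j \<or> r j \<le> l k; (\<Sum>k\<in>K. r k - l k) < d\<rbrakk>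
      \<Longrightarrow> (\<Sum>k\<in>K. norm (f (r k) - f (l k))) < e / 2 * (b - a)"
      by (rule abs_continuous_on_finite_family[OF f, where 'k = "real \<times> real set"]) blast
    have "E \<in> sets lebesgue" using E by (simp add: negligible_imp_sets)
    then obtain U where U: "open U" "E \<subseteq> U" "(U - E) \<in> lmeasurable" "emeasure lebesgue (U - E) < ennreal d"
      using sets_lebesgue_outer_open d by blast
    have UE: "U = (U - E) \<union> E" using U(2) by auto
    have Um: "U \<in> lmeasurable"
      using U(3) negligible_imp_measurable[OF E] UE fmeasurable.Un by metis
    have "measure lebesgue U \<le> measure lebesgue (U - E) + measure lebesgue E"
      using measure_Un_le[of "U - E" lebesgue E] U(3) UE negligible_imp_sets[OF E] by auto
    also have "\<dots> < d"
      using U(3,4) d negligible_imp_measure0[OF E]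
      by (simp add: emeasure_eq_measure2 ennreal_less_iff)
    finally have mU: "measure lebesgue U < d" .
    have ex1: "\<exists>\<rho>>0. \<forall>y\<in>{a..b}. \<bar>y - t\<bar> < \<rho> \<longrightarrow> norm (f y - f t - (y - t) *\<^sub>R g t) \<le> e / 2 * \<bar>y - t\<bar>"
      if "t \<in> {a..b} - E" for t
      using that e unfolding E_def
      by (auto simp: has_vector_derivative_def has_derivative_within_alt dest!: spec[of _ "e / 2"])
    have ex2: "\<exists>\<rho>>0. ball t \<rho> \<subseteq> U" if "t \<in> E" for t
      using that U open_contains_ball by blast
    have "\<exists>\<rho>>0. (t \<in> {a..b} - E \<longrightarrow> (\<forall>y\<in>{a..b}. \<bar>y - t\<bar> < \<rho> \<longrightarrow> norm (f y - f t - (y - t) *\<^sub>R g t) \<le> e / 2 * \<bar>y - t\<bar>))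
       \<and> (t \<in> E \<longrightarrow> ball t \<rho> \<subseteq> U)" for t
      using ex1[of t] ex2[of t] by (cases "t \<in> E"; cases "t \<in> {a..b}") (auto intro: exI[of _ 1])
    then obtain \<rho> where \<rho>: "\<And>t. \<rho> t > 0"
      "\<And>t y. \<lbrakk>t \<in> {a..b}; t \<notin> E; y \<in> {a..b}; \<bar>y - t\<bar> < \<rho> t\<rbrakk> \<Longrightarrow> norm (f y - f t - (y - t) *\<^sub>R g t) \<le> e / 2 * \<bar>y - t\<bar>"
      "\<And>t. t \<in> E \<Longrightarrow> ball t (\<rho> t) \<subseteq> U"
      by (metis DiffI)
    show "\<exists>d. gauge d \<and> (\<forall>p. p tagged_division_of {a..b} \<and> d fine p \<longrightarrow>
        norm ((\<Sum>(x,k)\<in>p. measure lborel k *\<^sub>R h x) - (f b - f a)) \<le> e * measure lborel {a..b})"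
    proof (intro exI[of _ "\<lambda>t. ball t (\<rho> t)"] conjI allI impI)
      show "gauge (\<lambda>t. ball t (\<rho> t))" using \<rho>(1) by (simp add: gauge_def)
      fix p assume "p tagged_division_of {a..b} \<and> (\<lambda>t. ball t (\<rho> t)) fine p"
      then have p: "p tagged_division_of {a..b}" and fine: "\<And>x K. (x,K) \<in> p \<Longrightarrow> K \<subseteq> ball x (\<rho> x)"
        by (auto simp: fine_def)
      note p' = tagged_division_ofD[OF p]
      define l where "l = (\<lambda>(x::real, K::real set). Inf K)"
      define r where "r = (\<lambda>(x::real, K::real set). Sup K)"
      have K_eq: "K = {l (x,K)..r (x,K)}" "l (x,K) \<le> x" "x \<le> r (x,K)" "a \<le> l (x,K)" "r (x,K) \<le> b"
        "measure lborel K = r (x,K) - l (x,K)" if xK: "(x,K) \<in> p" for x K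
      proof -
        obtain c d where cd: "K = {c..d}" using p'(4)[OF xK] by auto
        have "x \<in> K" "K \<subseteq> {a..b}" using p' xK by auto
        with cd show "K = {l (x,K)..r (x,K)}" "l (x,K) \<le> x" "x \<le> r (x,K)" "a \<le> l (x,K)" "r (x,K) \<le> b"
        "measure lborel K = r (x,K) - l (x,K)" by (auto simp: l_def r_def)
      qed
      have tel: "(\<Sum>k\<in>p. f (r k) - f (l k)) = f b - f a"
        using additive_tagged_division_1[OF less_imp_le[OF ab] p, of f]
        by (simp add: l_def r_def split_def)
      have tel1: "(\<Sum>k\<in>p. r k - l k) = b - a"
        using additive_tagged_division_1[OF less_imp_le[OF ab] p, of "\<lambda>x. x"]
        by (simp add: l_def r_def split_def)
      \<comment> \<open>A degenerate interval has empty interior and may lie inside another one, so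
        the separation property \<open>sep\<close> would fail for it. Dropping it costs nothing
        because its increment is zero.\<close>
      define q where "q = {k \<in> p. fst k \<in> E \<and> l k < r k}"
      have fin: "finite p" "finite q" using p'(1) by (auto simp: q_def)
      have disj: "{l k<..<r k} \<inter> {l j<..<r j} = {}" if "k \<in> p" "j \<in> p" "k \<noteq> j" for k j
      proof -
        obtain x K y J where [simp]: "k = (x,K)" "j = (y,J)" by (cases k, cases j)
        have "interior K = {l k<..<r k}" "interior J = {l j<..<r j}"
          using K_eq(1) that by (metis \<open>k = (x,K)\<close> interior_atLeastAtMost_real, metis \<open>j = (y,J)\<close> K_eq(1) that(2) interior_atLeastAtMost_real)
        then show ?thesis using p'(5)[of x K y J] that by auto
      qed
      have sep: "r k \<le> l j \<or> r j \<le> l k" if "k \<in> q" "j \<in> q" "k \<noteq> j" for k j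
      proof (rule ccontr)
        assume "\<not> ?thesis"
        then have "max (l k) (l j) < min (r k) (r j)" using that by (auto simp: q_def)
        then obtain z where "max (l k) (l j) < z" "z < min (r k) (r j)" using dense by blast
        then have "z \<in> {l k<..<r k} \<inter> {l j<..<r j}" by auto
        then show False using disj[of k j] that by (auto simp: q_def)
      qed
      have small: "(\<Sum>k\<in>q. norm (f (r k) - f (l k))) < e / 2 * (b - a)"
      proof (rule D)
        show "finite q" by fact
        show "a \<le> l k \<and> l k \<le> r k \<and> r k \<le> b" if "k \<in> q" for k
          using K_eq[of "fst k" "snd k", unfolded prod.collapse] that by (auto simp: q_def)
        have "(\<Sum>k\<in>q. r k - l k) = (\<Sum>k\<in>q. measure lebesgue {l k<..<r k})"
          by (intro sum.cong) (auto simp: q_def)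
        also have "\<dots> = measure lebesgue (\<Union>k\<in>q. {l k<..<r k})"
          using fin disj
          by (intro measure_finite_Union[symmetric]) (auto simp: disjoint_family_on_def q_def)
        also have "\<dots> \<le> measure lebesgue U"
        proof (rule measure_mono_fmeasurable[OF _ _ Um])
          show "(\<Union>k\<in>q. {l k<..<r k}) \<subseteq> U"
          proof (rule UN_least)
            fix k assume k: "k \<in> q"
            then have "snd k \<subseteq> ball (fst k) (\<rho> (fst k))" "snd k = {l k..r k}"
              using fine[of "fst k" "snd k", unfolded prod.collapse] K_eq(1)[of "fst k" "snd k", unfolded prod.collapse] by (auto simp: q_def)
            then show "{l k<..<r k} \<subseteq> U" using \<rho>(3)[of "fst k"] k by (fastforce simp: q_def)
          qed
        qed (use fin in auto)
        finally show "(\<Sum>k\<in>q. r k - l k) < d" using mU by simp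
      qed (use sep in auto)
      have summand: "norm (measure lborel (snd k) *\<^sub>R h (fst k) - (f (r k) - f (l k))) \<le> e / 2 * (r k - l k) +
          (if k \<in> q then norm (f (r k) - f (l k)) else 0)" if k: "k \<in> p" for k
      proof -
        obtain x K where [simp]: "k = (x,K)" by (cases k)
        note kk = K_eq[OF k[unfolded \<open>k = (x,K)\<close>]]
        have lr: "l k \<le> x" "x \<le> r k" "measure lborel K = r k - l k" using kk by auto
        have xab: "x \<in> {a..b}" "l k \<in> {a..b}" "r k \<in> {a..b}" using kk by auto
        show ?thesis
        proof (cases "x \<in> E")
          case True
          show ?thesis
          proof (cases "l k < r k")
            case True
            then have "k \<in> q" using \<open>x \<in> E\<close> k by (simp add: q_def)
            then show ?thesis using e lr \<open>x \<in> E\<close> by (simp add: h_def norm_minus_commute)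
          next
            case False
            then have "l k = r k" using lr by simp
            then show ?thesis using lr \<open>x \<in> E\<close> by (auto simp: h_def q_def)
          qed
        next
          case False
          have "K \<subseteq> ball x (\<rho> x)" using fine k by simp
          moreover have "K = {l k..r k}" unfolding \<open>k = (x,K)\<close> by (rule kk(1))
          ultimately have "l k \<in> ball x (\<rho> x)" "r k \<in> ball x (\<rho> x)" using lr(1,2) by (metis atLeastAtMost_iff order_refl order_trans subset_iff)+
          then have dd: "\<bar>l k - x\<bar> < \<rho> x" "\<bar>r k - x\<bar> < \<rho> x" by (auto simp: dist_real_def abs_minus_commute)
          have 1: "norm (f (l k) - f x - (l k - x) *\<^sub>R g x) \<le> e / 2 * \<bar>l k - x\<bar>"
            by (rule \<rho>(2)) (use xab False dd in auto)
          have 2: "norm (f (r k) - f x - (r k - x) *\<^sub>R g x) \<le> e / 2 * \<bar>r k - x\<bar>"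
            by (rule \<rho>(2)) (use xab False dd in auto)
          \<comment> \<open>Straddle estimate: the tag lies between the endpoints, so the two
            one-sided errors add up to a multiple of the length of the interval.\<close>
          have "norm (measure lborel K *\<^sub>R h x - (f (r k) - f (l k)))
            = norm ((f (l k) - f x - (l k - x) *\<^sub>R g x) - (f (r k) - f x - (r k - x) *\<^sub>R g x))"
            unfolding lr(3) using False by (simp add: h_def algebra_simps)
          also have "\<dots> \<le> e / 2 * \<bar>l k - x\<bar> + e / 2 * \<bar>r k - x\<bar>"
            by (rule norm_triangle_le_diff[OF add_mono[OF 1 2]])
          also have "\<dots> = e / 2 * (r k - l k)" using lr by (simp add: algebra_simps)
          finally show ?thesis using False by (simp add: q_def)
        qed
      qed
      have "(\<Sum>(x,k)\<in>p. measure lborel k *\<^sub>R h x) - (f b - f a) = (\<Sum>k\<in>p. measure lborel (snd k) *\<^sub>R h (fst k) - (f (r k) - f (l k)))"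
        unfolding tel[symmetric] by (simp add: sum_subtractf split_def)
      then have "norm ((\<Sum>(x,k)\<in>p. measure lborel k *\<^sub>R h x) - (f b - f a))
         \<le> (\<Sum>k\<in>p. e / 2 * (r k - l k) + (if k \<in> q then norm (f (r k) - f (l k)) else 0))"
        using summand by (simp add: sum_norm_le)
      also have "\<dots> = e / 2 * (b - a) + (\<Sum>k\<in>q. norm (f (r k) - f (l k)))"
      proof -
        have "q = {k \<in> p. k \<in> q}" by (auto simp: q_def)
        then have "(\<Sum>k\<in>p. if k \<in> q then norm (f (r k) - f (l k)) else 0) = (\<Sum>k\<in>q. norm (f (r k) - f (l k)))"
          using sum.inter_filter[OF fin(1), of "\<lambda>k. norm (f (r k) - f (l k))" "\<lambda>k. k \<in> q"] by simp
        then show ?thesis unfolding tel1[symmetric] by (simp only: sum.distrib sum_distrib_left)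
      qed
      also have "\<dots> \<le> e * (b - a)" using small by (simp add: field_simps)
      finally show "norm ((\<Sum>(x,k)\<in>p. measure lborel k *\<^sub>R h x) - (f b - f a)) \<le> e * measure lborel {a..b}"
        using ab by simp
    qed
  qed
  then show ?thesis
    by (rule has_integral_spike[OF E, rotated]) (auto simp: h_def)
qed

section \<open>Almost everywhere differentiability of indefinite integrals\<close>

text \<open>
  If the difference quotients at each point of a set \<open>E n\<close> are, on arbitrarily short intervals, off
  from \<open>f\<close> by more than \<open>1 / (n + 1)\<close>, these intervals form a Vitali cover of \<open>E n\<close>. A finite disjoint subfamily is a tagged partial
  division, so by the Henstock lemma its total length is arbitrarily small.
\<close>

theorem AE_integral_has_vector_derivative:
  fixes f :: "real \<Rightarrow> 'a::euclidean_space"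
  assumes f: "f integrable_on {a..b}"
  shows "AE t in lborel. t \<in> {a..b} \<longrightarrow>
           ((\<lambda>t. integral {a..t} f) has_vector_derivative f t) (at t within {a..b})"
proof -
  define F where "F t = integral {a..t} f" for t
  define E where "E n = {t \<in> {a..b}. \<forall>d>0. \<exists>y\<in>{a..b}. \<bar>y - t\<bar> < d \<and>
      norm (F y - F t - (y - t) *\<^sub>R f t) > \<bar>y - t\<bar> / real (Suc n)}" for n
  have neg: "negligible (E n)" for n
    unfolding negligible_outer_le
  proof (intro allI impI)
    fix e :: real assume e: "e > 0"
    \<comment> \<open>The factor \<open>n + 1\<close> is paid here because an interval of the cover
      has an error of more than its length divided by \<open>n + 1\<close>; the total length then
      stays below \<open>e\<close>.\<close>
    then have "e / real (Suc n) > 0" by simp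
    then obtain \<gamma> where \<gamma>: "gauge \<gamma>" and H: "\<And>p. \<lbrakk>p tagged_partial_division_of {a..b}; \<gamma> fine p\<rbrakk> \<Longrightarrow>
             (\<Sum>(x,k)\<in>p. norm (measure lborel k *\<^sub>R f x - integral k f)) < e / real (Suc n)"
      by (rule Henstock_lemma[of f a b, unfolded box_real, OF f]) blast
    \<comment> \<open>An index \<open>(t, y)\<close> consists of a tag and a point witnessing the
      bad difference quotient; its interval lies between them. \<open>c\<close> and \<open>r\<close>
      rewrite this interval as a ball, the shape that the Vitali covering theorem works
      with.\<close>
    define I where "I = (\<lambda>(t, y). {min t y..max t y :: real})"
    define c where "c = (\<lambda>(t, y). (t + y) / 2 :: real)"
    define r where "r = (\<lambda>(t, y). \<bar>y - t\<bar> / 2 :: real)"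
    define K where "K = {(t, y). t \<in> E n \<and> y \<in> {a..b} \<and> y \<noteq> t \<and> I (t, y) \<subseteq> \<gamma> t \<and>
      norm (F y - F t - (y - t) *\<^sub>R f t) > \<bar>y - t\<bar> / real (Suc n)}"
    have cball: "cball (c k) (r k) = I k" for k
      by (cases k) (auto simp: c_def r_def I_def cball_eq_atLeastAtMost field_simps min_def max_def abs_if)
    obtain C where C: "countable C" "C \<subseteq> K"
      "pairwise (\<lambda>i j. disjnt (cball (c i) (r i)) (cball (c j) (r j))) C"
      "negligible (E n - (\<Union>i \<in> C. cball (c i) (r i)))"
    proof (rule Vitali_covering_theorem_cballs[of K r "E n" c])
      show "0 < r k" if "k \<in> K" for k using that by (auto simp: K_def r_def)
      fix x d :: real assume x: "x \<in> E n" and d: "0 < d"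
      have "open (\<gamma> x)" "x \<in> \<gamma> x" using \<gamma> by (auto simp: gauge_def)
      then obtain \<delta> where \<delta>: "\<delta> > 0" "ball x \<delta> \<subseteq> \<gamma> x" using open_contains_ball by blast
      obtain y where y: "y \<in> {a..b}" "\<bar>y - x\<bar> < min \<delta> d" "norm (F y - F x - (y - x) *\<^sub>R f x) > \<bar>y - x\<bar> / real (Suc n)"
        using x d \<delta>(1) by (auto simp: E_def dest!: spec[of _ "min \<delta> d"])
      have "y \<noteq> x" using y(3) by auto
      moreover have "I (x, y) \<subseteq> ball x \<delta>" using y(2) by (auto simp: I_def dist_real_def min_def max_def split: if_splits)
      ultimately have "(x, y) \<in> K" using x y \<delta> by (auto simp: K_def)
      moreover have "x \<in> cball (c (x, y)) (r (x, y))" unfolding cball by (simp add: I_def)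
      moreover have "r (x, y) < d" using y(2) d by (simp add: r_def)
      ultimately show "\<exists>i. i \<in> K \<and> x \<in> cball (c i) (r i) \<and> r i < d" by blast
    qed
    have fin_bound: "measure lebesgue (\<Union>i\<in>D. I i) \<le> e" if D: "D \<subseteq> C" "finite D" for D
    proof -
      define p where "p = (\<lambda>k. (fst k, I k)) ` D"
      have DK: "\<And>k. k \<in> D \<Longrightarrow> k \<in> K" using D C(2) by auto
      have disj: "I i \<inter> I j = {}" if "i \<in> D" "j \<in> D" "i \<noteq> j" for i j
        using C(3) D(1) that unfolding cball by (auto simp: pairwise_def disjnt_def)
      have ne: "fst k \<in> I k" for k by (cases k) (simp add: I_def)
      \<comment> \<open>Each interval contains its own tag and different intervals are disjoint, so
        the sum over \<open>p\<close> can be written as a sum over \<open>D\<close>.\<close>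
      have inj: "inj_on (\<lambda>k. (fst k, I k)) D"
        using disj ne by (intro inj_onI) (metis IntI empty_iff prod.inject)
      have p: "p tagged_partial_division_of {a..b}"
        unfolding tagged_partial_division_of_def
      proof (intro conjI allI impI)
        show "finite p" using D by (simp add: p_def)
        fix x L assume "(x, L) \<in> p"
        then obtain y where xy: "(x, y) \<in> D" "L = I (x, y)" by (auto simp: p_def)
        then have "(x, y) \<in> K" using DK by auto
        then show "x \<in> L" "L \<subseteq> {a..b}" using xy by (auto simp: K_def I_def E_def)
        show "\<exists>a b. L = cbox a b" using xy by (auto simp: I_def)
      next
        fix x1 K1 x2 K2 assume "(x1, K1) \<in> p \<and> (x2, K2) \<in> p \<and> (x1, K1) \<noteq> (x2, K2)"
        then have "K1 \<inter> K2 = {}" using disj by (fastforce simp: p_def)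
        then show "interior K1 \<inter> interior K2 = {}" using interior_subset by blast
      qed
      have "\<gamma> fine p" using DK by (force simp: fine_def p_def K_def)
      from H[OF p this]
      have total: "(\<Sum>k\<in>D. norm (measure lborel (I k) *\<^sub>R f (fst k) - integral (I k) f)) < e / real (Suc n)"
        unfolding p_def by (subst (asm) sum.reindex[OF inj]) (simp add: o_def)
      have "measure lebesgue (I k) / real (Suc n) \<le> norm (measure lborel (I k) *\<^sub>R f (fst k) - integral (I k) f)" if "k \<in> D" for k
      proof -
        obtain t y where k: "k = (t, y)" by (cases k)
        have tK: "t \<in> {a..b}" "y \<in> {a..b}" "norm (F y - F t - (y - t) *\<^sub>R f t) > \<bar>y - t\<bar> / real (Suc n)"
          using DK[OF that] by (auto simp: k K_def E_def)
        have inc: "integral {s..t} f = F t - F s" if "a \<le> s" "s \<le> t" "t \<le> b" for s t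
          using Henstock_Kurzweil_Integration.integral_combine[of a s t f] that
             integrable_subinterval_real[OF f, of a t]
          by (simp add: F_def algebra_simps)
        have "norm (measure lborel (I k) *\<^sub>R f (fst k) - integral (I k) f) = norm (F y - F t - (y - t) *\<^sub>R f t)"
        proof (cases "t \<le> y")
          case True
          then have "measure lborel (I k) *\<^sub>R f (fst k) - integral (I k) f = - (F y - F t - (y - t) *\<^sub>R f t)"
            using tK by (simp add: I_def k inc)
          then show ?thesis by (metis norm_minus_cancel)
        next
          case False
          then have "measure lborel (I k) *\<^sub>R f (fst k) - integral (I k) f = F y - F t - (y - t) *\<^sub>R f t"
            using tK by (simp add: I_def k inc algebra_simps)
          then show ?thesis by simp
        qed
        moreover have "measure lebesgue (I k) = \<bar>y - t\<bar>" by (auto simp: I_def k)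
        ultimately show ?thesis using tK(3) by simp
      qed
      then have "(\<Sum>k\<in>D. measure lebesgue (I k) / real (Suc n))
          \<le> (\<Sum>k\<in>D. norm (measure lborel (I k) *\<^sub>R f (fst k) - integral (I k) f))"
        by (rule sum_mono)
      with total have "(\<Sum>k\<in>D. measure lebesgue (I k) / real (Suc n)) < e / real (Suc n)"
        by linarith
      then have "(\<Sum>k\<in>D. measure lebesgue (I k)) < e"
        by (simp add: divide_less_cancel flip: sum_divide_distrib)
      moreover have "measure lebesgue (\<Union>i\<in>D. I i) \<le> (\<Sum>k\<in>D. measure lebesgue (I k))"
        using D by (intro measure_UNION_le) (auto simp: I_def)
      ultimately show ?thesis by simp
    qed
    \<comment> \<open>The measure bound is uniform over finite subfamilies and therefore passes to
      the countable union. The part of \<open>E n\<close> that the Vitali family misses is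
      negligible.\<close>
    define W where "W = (\<Union>i\<in>C. I i)"
    have "I i \<in> lmeasurable" for i by (cases i) (simp add: I_def)
    then have W: "W \<in> lmeasurable" "measure lebesgue W \<le> e"
      unfolding W_def
      using fmeasurable_UN_bound[where I = C and A = I and M = lebesgue and B = e]
        measure_UN_bound[where I = C and A = I and M = lebesgue and B = e] C(1) fin_bound by blast+
    have N: "negligible (E n - W)" using C(4) by (simp add: cball W_def)
    have "W \<union> (E n - W) \<in> lmeasurable" using W(1) negligible_imp_measurable[OF N] by (rule fmeasurable.Un)
    moreover have "measure lebesgue (W \<union> (E n - W)) \<le> e"
      using measure_Un_le[of W lebesgue "E n - W"] W(2) fmeasurableD[OF W(1)]
        negligible_imp_sets[OF N] negligible_imp_measure0[OF N] by linarith
    moreover have "E n \<subseteq> W \<union> (E n - W)" by blast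
    ultimately show "\<exists>T. E n \<subseteq> T \<and> T \<in> lmeasurable \<and> measure lebesgue T \<le> e" by blast
  qed
  have "{t. \<not> (t \<in> {a..b} \<longrightarrow> (F has_vector_derivative f t) (at t within {a..b}))} \<subseteq> (\<Union>n. E n)"
  proof
    fix t assume "t \<in> {t. \<not> (t \<in> {a..b} \<longrightarrow> (F has_vector_derivative f t) (at t within {a..b}))}"
    then have t: "t \<in> {a..b}" "\<not> (F has_vector_derivative f t) (at t within {a..b})" by auto
    then obtain e where e: "e > 0" and N: "\<not> (\<exists>d>0. \<forall>y\<in>{a..b}. \<bar>y - t\<bar> < d \<longrightarrow> norm (F y - F t - (y - t) *\<^sub>R f t) \<le> e * \<bar>y - t\<bar>)"
      by (auto simp: has_vector_derivative_def has_derivative_within_alt bounded_linear_scaleR_left)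
    obtain n where n: "1 / real (Suc n) < e" using nat_approx_posE[OF e] by blast
    have "t \<in> E n"
      unfolding E_def
    proof (intro CollectI conjI allI impI t)
      fix d :: real assume "d > 0"
      then obtain y where y: "y \<in> {a..b}" "\<bar>y - t\<bar> < d" "norm (F y - F t - (y - t) *\<^sub>R f t) > e * \<bar>y - t\<bar>"
        using N by (meson not_le)
      have "1 / real (Suc n) * \<bar>y - t\<bar> \<le> e * \<bar>y - t\<bar>" using n by (intro mult_right_mono) auto
      then show "\<exists>y\<in>{a..b}. \<bar>y - t\<bar> < d \<and> \<bar>y - t\<bar> / real (Suc n) < norm (F y - F t - (y - t) *\<^sub>R f t)"
        using y by (intro bexI[of _ y]) auto
    qed
    then show "t \<in> (\<Union>n. E n)" by blast
  qed
  moreover have "negligible (\<Union>n. E n)" by (intro negligible_countable_Union) (use neg in auto)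
  ultimately show ?thesis
    unfolding AE_lborel_iff_negligible F_def[symmetric, abs_def] by (rule negligible_subset[rotated])
qed

section \<open>Absolute continuity of indefinite integrals\<close>

lemma sum_integral_nonoverlapping_le:
  fixes q :: "real \<Rightarrow> real"
  assumes q: "q integrable_on {a..b}" and pos: "\<And>t. t \<in> {a..b} \<Longrightarrow> 0 \<le> q t" and "finite K"
    and sub: "\<And>k. k \<in> K \<Longrightarrow> a \<le> l k \<and> l k \<le> r k \<and> r k \<le> b"
    and sep: "\<And>k j. \<lbrakk>k \<in> K; j \<in> K; k \<noteq> j\<rbrakk> \<Longrightarrow> r k \<le> l j \<or> r j \<le> l k"
  shows "(\<Sum>k\<in>K. integral {l k..r k} q) \<le> integral {a..b} q"
proof -
  have "(q has_integral (\<Sum>k\<in>K. integral {l k..r k} q)) (\<Union>k\<in>K. {l k..r k})"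
  proof (rule has_integral_UN[OF \<open>finite K\<close>])
    show "(q has_integral integral {l k..r k} q) {l k..r k}" if "k \<in> K" for k
      using integrable_subinterval_real[OF q, of "l k" "r k"] sub[OF that] by (auto intro: integrable_integral)
    show "pairwise (\<lambda>i i'. negligible ({l i..r i} \<inter> {l i'..r i'})) K"
    proof (rule pairwiseI)
      fix i j assume "i \<in> K" "j \<in> K" "i \<noteq> j"
      then have "r i \<le> l j \<or> r j \<le> l i" by (rule sep)
      then have "{l i..r i} \<inter> {l j..r j} \<subseteq> {r i, r j}" by auto
      then show "negligible ({l i..r i} \<inter> {l j..r j})" by (rule negligible_subset[rotated]) simp
    qed
  qed
  moreover have "(q has_integral integral {a..b} q) {a..b}" using q by (rule integrable_integral)
  moreover have "(\<Union>k\<in>K. {l k..r k}) \<subseteq> {a..b}" using sub by fastforce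
  ultimately show ?thesis using pos by (blast intro: has_integral_subset_le)
qed

text \<open>Cut \<open>norm (f t)\<close> off at a large height \<open>k\<close>. The part above
  \<open>k\<close> has integral below \<open>e / 2\<close> by dominated convergence, and the bounded
  part contributes at most \<open>k\<close> times the total length of the intervals.\<close>

lemma abs_continuous_on_integral:
  fixes f :: "real \<Rightarrow> 'a::euclidean_space"
  assumes f: "f absolutely_integrable_on {a..b}"
  shows "abs_continuous_on a b (\<lambda>t. integral {a..t} f)"
  unfolding abs_continuous_on_def
proof (intro allI impI)
  fix e :: real assume e: "e > 0"
  define h where "h t = norm (f t)" for t
  have fi: "f integrable_on {a..b}" using f set_lebesgue_integral_eq_integral(1) by blast
  have h: "h absolutely_integrable_on {a..b}"
    unfolding h_def using f by (rule absolutely_integrable_norm[unfolded o_def])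
  have hi: "h integrable_on {a..b}" using h set_lebesgue_integral_eq_integral(1) by blast
  have mi: "(\<lambda>t. min (h t) (real k)) integrable_on {a..b}" for k
    using absolutely_integrable_min_1[OF h, of "\<lambda>_. real k"] set_lebesgue_integral_eq_integral(1) by auto
  have "(\<lambda>k. integral {a..b} (\<lambda>t. min (h t) (real k))) \<longlonglongrightarrow> integral {a..b} h"
  proof (rule dominated_convergence(2)[OF mi hi])
    show "norm (min (h t) (real k)) \<le> h t" for k t by (simp add: h_def)
    show "(\<lambda>k. min (h t) (real k)) \<longlonglongrightarrow> h t" for t
      by (rule tendsto_eventually, rule eventually_mono[OF eventually_ge_at_top[of "nat \<lceil>h t\<rceil>"]]) linarith
  qed
  then have "eventually (\<lambda>k. integral {a..b} h - e / 2 < integral {a..b} (\<lambda>t. min (h t) (real k))) sequentially"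
    using e by (intro order_tendstoD) auto
  then obtain k where k: "integral {a..b} h - e / 2 < integral {a..b} (\<lambda>t. min (h t) (real k))"
    by (auto simp: eventually_sequentially)
  define q where "q t = h t - min (h t) (real k)" for t
  have qi: "q integrable_on {a..b}" unfolding q_def using hi mi by (rule integrable_diff)
  have q_small: "integral {a..b} q < e / 2"
    unfolding q_def using k by (simp add: integral_diff[OF hi mi])
  \<comment> \<open>Chosen so that \<open>(k + 1) * d = e / 2\<close>; the added one also covers
    \<open>k = 0\<close>.\<close>
  define d where "d = e / (2 * (real k + 1))"
  have d: "d > 0" using e by (simp add: d_def)
  show "\<exists>\<delta>>0. \<forall>(n::nat) I. (\<forall>k<n. a \<le> fst (I k) \<and> fst (I k) \<le> snd (I k) \<and> snd (I k) \<le> b) \<and>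
               (\<forall>k<n. \<forall>l<n. k \<noteq> l \<longrightarrow> snd (I k) \<le> fst (I l) \<or> snd (I l) \<le> fst (I k)) \<and>
               (\<Sum>k<n. snd (I k) - fst (I k)) < \<delta> \<longrightarrow>
               (\<Sum>k<n. norm (integral {a..snd (I k)} f - integral {a..fst (I k)} f)) < e"
  proof (intro exI[of _ d] conjI allI impI)
    fix n :: nat and I :: "nat \<Rightarrow> real \<times> real"
    assume A: "(\<forall>k<n. a \<le> fst (I k) \<and> fst (I k) \<le> snd (I k) \<and> snd (I k) \<le> b) \<and>
               (\<forall>k<n. \<forall>l<n. k \<noteq> l \<longrightarrow> snd (I k) \<le> fst (I l) \<or> snd (I l) \<le> fst (I k)) \<and>
               (\<Sum>k<n. snd (I k) - fst (I k)) < d"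
    have "norm (integral {a..snd (I j)} f - integral {a..fst (I j)} f)
          \<le> integral {fst (I j)..snd (I j)} q + real k * (snd (I j) - fst (I j))" if "j < n" for j
    proof -
      define l r where "l = fst (I j)" and "r = snd (I j)"
      have lr: "a \<le> l" "l \<le> r" "r \<le> b" using A that by (auto simp: l_def r_def)
      have sub: "g integrable_on {l..r}" if "g integrable_on {a..b}" for g :: "real \<Rightarrow> 'c::banach"
        using integrable_subinterval_real[OF that, of l r] lr by auto
      have "integral {a..r} f - integral {a..l} f = integral {l..r} f"
        using Henstock_Kurzweil_Integration.integral_combine[of a l r f] lr
             integrable_subinterval_real[OF fi, of a r] by (simp add: algebra_simps)
      also have "norm \<dots> \<le> integral {l..r} (\<lambda>t. q t + real k)"
      proof (rule Henstock_Kurzweil_Integration.integral_norm_bound_integral[OF sub[OF fi]])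
        show "(\<lambda>t. q t + real k) integrable_on {l..r}" by (intro integrable_add sub qi) auto
        show "norm (f t) \<le> q t + real k" for t by (simp add: q_def h_def)
      qed
      also have "\<dots> = integral {l..r} q + real k * (r - l)"
        using lr by (subst integral_add[OF sub[OF qi]]) auto
      finally show ?thesis by (simp add: l_def r_def)
    qed
    then have "(\<Sum>k<n. norm (integral {a..snd (I k)} f - integral {a..fst (I k)} f))
       \<le> (\<Sum>j<n. integral {fst (I j)..snd (I j)} q + real k * (snd (I j) - fst (I j)))"
      by (intro sum_mono) auto
    also have "\<dots> = (\<Sum>j<n. integral {fst (I j)..snd (I j)} q) + real k * (\<Sum>j<n. snd (I j) - fst (I j))"
      by (simp add: sum.distrib sum_distrib_left)
    also have "\<dots> \<le> integral {a..b} q + real k * d"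
      using A by (intro add_mono sum_integral_nonoverlapping_le[OF qi] mult_left_mono) (auto simp: q_def)
    also have "\<dots> < e / 2 + (real k + 1) * d"
      using q_small d by (intro add_strict_mono mult_strict_right_mono) auto
    also have "\<dots> = e" by (simp add: d_def field_simps)
    finally show "(\<Sum>k<n. norm (integral {a..snd (I k)} f - integral {a..fst (I k)} f)) < e" .
  qed fact
qed

section \<open>Caratheodory integral equations\<close>

text \<open>The first factor is discrete, so a preimage is a union of open slices, one for each
  natural number.\<close>

lemma continuous_on_nat_prod:
  fixes f :: "nat \<Rightarrow> 'a::topological_space \<Rightarrow> 'b::topological_space"
  assumes "\<And>i. continuous_on UNIV (f i)"
  shows "continuous_on UNIV (\<lambda>(i, t). f i t)"
  unfolding continuous_on_open_vimage[OF open_UNIV]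
proof (intro allI impI)
  fix U :: "'b set" assume U: "open U"
  have "(\<lambda>(i, t). f i t) -` U \<inter> UNIV = (\<Union>i. {i} \<times> (f i -` U \<inter> UNIV))" by auto
  moreover have "open (f i -` U \<inter> UNIV)" for i
    using assms[of i] U unfolding continuous_on_open_vimage[OF open_UNIV] by blast
  ultimately show "open ((\<lambda>(i, t). f i t) -` U \<inter> UNIV)"
    by (auto intro!: open_Times open_discrete)
qed

text \<open>The library provides this only for a metric domain, but the domain \<open>nat \<times> real\<close> below is
  not an instance of that class.\<close>

lemma complete_UNIV_bcontfun: "complete (UNIV :: ('a::topological_space \<Rightarrow>\<^sub>C 'b::complete_space) set)"
  unfolding complete_def
proof (intro allI impI)
  fix f :: "nat \<Rightarrow> 'a \<Rightarrow>\<^sub>C 'b" assume "(\<forall>n. f n \<in> UNIV) \<and> Cauchy f"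
  then have "uniformly_Cauchy_on UNIV (\<lambda>n. apply_bcontfun (f n))"
    unfolding Cauchy_def uniformly_Cauchy_on_def by (meson dist_fun_lt_imp_dist_val_lt)
  then obtain g where "uniform_limit UNIV (\<lambda>n. apply_bcontfun (f n)) g sequentially"
    using Cauchy_uniformly_convergent uniformly_convergent_on_def by blast
  then show "\<exists>l\<in>UNIV. f \<longlonglongrightarrow> l"
    using uniform_limit_bcontfunE[OF _ sequentially_bot] by blast
qed

text \<open>\<open>exp (2 * \<Phi>) / 2\<close> is absolutely continuous and its a.e. derivative is
  the integrand. The 2 in the exponent produces the contraction factor \<open>1 / 2\<close> of the
  weighted Picard map.\<close>

lemma has_integral_exp_indefinite_integral:
  fixes L :: "real \<Rightarrow> real"
  assumes L: "L absolutely_integrable_on {0..T}" and pos: "\<And>t. t \<in> {0..T} \<Longrightarrow> 0 \<le> L t"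
    and t: "t \<in> {0..T}"
  shows "((\<lambda>s. L s * exp (2 * integral {0..s} L)) has_integral (exp (2 * integral {0..t} L) - 1) / 2) {0..t}"
proof -
  define \<Phi> where "\<Phi> s = integral {0..s} L" for s
  have Li: "L integrable_on {0..T}" using L set_lebesgue_integral_eq_integral(1) by blast
  have mono: "\<Phi> r \<le> \<Phi> s" if "0 \<le> r" "r \<le> s" "s \<le> T" for r s
    unfolding \<Phi>_def using that pos
    by (intro integral_subset_le integrable_subinterval_real[OF Li]) auto
  have ac: "abs_continuous_on 0 t \<Phi>"
    unfolding \<Phi>_def using abs_continuous_on_integral[OF L] t
    by (auto intro: abs_continuous_on_subinterval)
  \<comment> \<open>The inequality \<open>1 - exp (- a) \<le> a\<close> bounds increments of the
    exponential by those of \<open>\<Phi>\<close>. Passing \<open>ac\<close> twice accounts for the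
    factor 2.\<close>
  have "abs_continuous_on 0 t (\<lambda>s. exp (2 * \<Phi> s) / 2)"
  proof (rule abs_continuous_on_dominated[OF ac ac, where C = "exp (2 * \<Phi> T)"])
    fix r s assume rs: "0 \<le> r" "r \<le> s" "s \<le> t"
    then have m: "\<Phi> r \<le> \<Phi> s" "\<Phi> s \<le> \<Phi> T" using t by (auto intro!: mono)
    have "exp (2 * \<Phi> s) - exp (2 * \<Phi> r) = exp (2 * \<Phi> s) * (1 - exp (- (2 * (\<Phi> s - \<Phi> r))))"
      by (simp add: right_diff_distrib flip: exp_add)
    also have "\<dots> \<le> exp (2 * \<Phi> T) * (2 * (\<Phi> s - \<Phi> r))"
    proof (rule mult_mono)
      show "1 - exp (- (2 * (\<Phi> s - \<Phi> r))) \<le> 2 * (\<Phi> s - \<Phi> r)"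
        using exp_ge_add_one_self[of "- (2 * (\<Phi> s - \<Phi> r))"] by linarith
    qed (use m in auto)
    finally have le: "exp (2 * \<Phi> s) - exp (2 * \<Phi> r) \<le> exp (2 * \<Phi> T) * (2 * (\<Phi> s - \<Phi> r))" .
    have "0 \<le> exp (2 * \<Phi> s) - exp (2 * \<Phi> r)" using m by simp
    then have "norm (exp (2 * \<Phi> s) / 2 - exp (2 * \<Phi> r) / 2) \<le> exp (2 * \<Phi> s) - exp (2 * \<Phi> r)"
      by (simp flip: diff_divide_distrib)
    also note le
    also have "exp (2 * \<Phi> T) * (2 * (\<Phi> s - \<Phi> r)) = exp (2 * \<Phi> T) * (norm (\<Phi> s - \<Phi> r) + norm (\<Phi> s - \<Phi> r))"
      using m by simp
    finally show "norm (exp (2 * \<Phi> s) / 2 - exp (2 * \<Phi> r) / 2)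
        \<le> exp (2 * \<Phi> T) * (norm (\<Phi> s - \<Phi> r) + norm (\<Phi> s - \<Phi> r))" .
  qed
  moreover have "AE s in lborel. s \<in> {0..t} \<longrightarrow>
     ((\<lambda>s. exp (2 * \<Phi> s) / 2) has_vector_derivative L s * exp (2 * \<Phi> s)) (at s within {0..t})"
    using AE_integral_has_vector_derivative[OF Li]
  proof (rule AE_mp, intro AE_I2 impI)
    fix s assume "s \<in> {0..T} \<longrightarrow> ((\<lambda>t. integral {0..t} L) has_vector_derivative L s) (at s within {0..T})"
      and s: "s \<in> {0..t}"
    then have "(\<Phi> has_vector_derivative L s) (at s within {0..t})"
      using t unfolding \<Phi>_def[abs_def] by (auto intro: has_vector_derivative_within_subset)
    then have "(\<Phi> has_real_derivative L s) (at s within {0..t})"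
      by (simp add: has_real_derivative_iff_has_vector_derivative)
    then have "((\<lambda>s. exp (2 * \<Phi> s) / 2) has_real_derivative L s * exp (2 * \<Phi> s)) (at s within {0..t})"
      by (auto intro!: derivative_eq_intros)
    then show "((\<lambda>s. exp (2 * \<Phi> s) / 2) has_vector_derivative L s * exp (2 * \<Phi> s)) (at s within {0..t})"
      by (simp add: has_real_derivative_iff_has_vector_derivative)
  qed
  ultimately have "((\<lambda>s. L s * exp (2 * \<Phi> s)) has_integral exp (2 * \<Phi> t) / 2 - exp (2 * \<Phi> 0) / 2) {0..t}"
    using t by (intro abs_continuous_on_has_integral) auto
  moreover have "\<Phi> 0 = 0" by (simp add: \<Phi>_def)
  ultimately show ?thesis unfolding \<Phi>_def by (simp add: diff_divide_distrib)
qed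

text \<open>The iteration runs on \<open>exp (- 2 * \<Phi>) * z\<close> rather than on
  \<open>z\<close>. With this weight the Picard map contracts by \<open>1 / 2\<close> however large
  the integral of \<open>L\<close> is, so one application of the Banach theorem covers all of
  \<open>[0, T]\<close>. Integrability of the right-hand side is required along continuous
  trajectories.\<close>

theorem caratheodory_integral_equation:
  fixes F :: "nat \<Rightarrow> real \<Rightarrow> (nat \<Rightarrow> 'b) \<Rightarrow> 'b::euclidean_space" and L :: "real \<Rightarrow> real"
  assumes I: "finite I" and T: "0 \<le> T"
    and L: "L absolutely_integrable_on {0..T}" and Lpos: "\<And>t. t \<in> {0..T} \<Longrightarrow> 0 \<le> L t"
    and int: "\<And>z i. \<lbrakk>\<And>j. j \<in> I \<Longrightarrow> continuous_on {0..T} (z j); i \<in> I\<rbrakk>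
       \<Longrightarrow> (\<lambda>t. F i t (\<lambda>j. z j t)) integrable_on {0..T}"
    and lip: "\<And>i t y y' K. \<lbrakk>i \<in> I; t \<in> {0..T}; \<And>j. j \<in> I \<Longrightarrow> norm (y j - y' j) \<le> K\<rbrakk>
       \<Longrightarrow> norm (F i t y - F i t y') \<le> L t * K"
  obtains z where "\<And>i. i \<in> I \<Longrightarrow> continuous_on {0..T} (z i)"
    "\<And>i t. \<lbrakk>i \<in> I; t \<in> {0..T}\<rbrakk> \<Longrightarrow> ((\<lambda>s. F i s (\<lambda>j. z j s)) has_integral (z i t - z0 i)) {0..t}"
    "\<And>z' i t. \<lbrakk>\<And>i. i \<in> I \<Longrightarrow> continuous_on {0..T} (z' i);
       \<And>i t. \<lbrakk>i \<in> I; t \<in> {0..T}\<rbrakk> \<Longrightarrow> ((\<lambda>s. F i s (\<lambda>j. z' j s)) has_integral (z' i t - z0 i)) {0..t};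
       i \<in> I; t \<in> {0..T}\<rbrakk> \<Longrightarrow> z' i t = z i t"
proof -
  define \<Phi> where "\<Phi> s = integral {0..s} L" for s
  define p where "p t = max 0 (min T t)" for t
  have p: "p t \<in> {0..T}" "t \<in> {0..T} \<Longrightarrow> p t = t" for t using T by (auto simp: p_def)
  have pcont: "continuous_on UNIV p" unfolding p_def by (intro continuous_intros)
  have Li: "L integrable_on {0..T}" using L set_lebesgue_integral_eq_integral(1) by blast
  have \<Phi>cont: "continuous_on {0..T} \<Phi>"
    unfolding \<Phi>_def using Li by (rule indefinite_integral_continuous_1)
  \<comment> \<open>Time is clamped to \<open>[0, T]\<close> by \<open>p\<close>, and all components are packed into one function on
    \<open>nat \<times> real\<close>, so that the sup norm takes care of the maximum over the particles.\<close>
  define emb :: "(nat \<Rightarrow> real \<Rightarrow> 'b) \<Rightarrow> (nat \<times> real) \<Rightarrow>\<^sub>C 'b" where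
    "emb h = Bcontfun (\<lambda>(i, t). if i \<in> I then h i (p t) else 0)" for h
  have emb: "apply_bcontfun (emb h) (i, t) = (if i \<in> I then h i (p t) else 0)"
    if h: "\<And>i. i \<in> I \<Longrightarrow> continuous_on {0..T} (h i)" for h i t
  proof -
    have "(\<lambda>(i, t). if i \<in> I then h i (p t) else 0) \<in> bcontfun"
      unfolding bcontfun_def
    proof (intro CollectI conjI continuous_on_nat_prod)
      show "continuous_on UNIV (\<lambda>t. if i \<in> I then h i (p t) else 0)" for i
        using continuous_on_compose2[OF h pcont, of i] p(1) by (cases "i \<in> I") (auto simp: image_subset_iff)
      have "bounded (h i ` {0..T})" if "i \<in> I" for i
        using compact_continuous_image[OF h[OF that] compact_Icc] by (rule compact_imp_bounded)
      then have "bounded (insert 0 (\<Union>i\<in>I. h i ` {0..T}))" using I by (simp add: bounded_UN)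
      moreover have "(if i \<in> I then h i (p t) else 0) \<in> insert 0 (\<Union>i\<in>I. h i ` {0..T})" for i t
        using p(1)[of t] by (cases "i \<in> I") (simp_all del: atLeastAtMost_iff, blast)
      then have "range (\<lambda>(i, t). if i \<in> I then h i (p t) else 0) \<subseteq> insert 0 (\<Union>i\<in>I. h i ` {0..T})"
        by (intro image_subsetI) (simp only: split_beta)
      ultimately show "bounded (range (\<lambda>(i, t). if i \<in> I then h i (p t) else 0))"
        by (rule bounded_subset)
    qed
    then show ?thesis unfolding emb_def by (simp add: Bcontfun_inverse)
  qed
  \<comment> \<open>\<open>S\<close> removes the exponential weight, \<open>J\<close> is the usual
    Picard map on trajectories, and \<open>G\<close> below is \<open>J\<close> conjugated by the
    weight.\<close>
  define S where "S w i t = exp (2 * \<Phi> t) *\<^sub>R apply_bcontfun w (i, t)" for w :: "(nat \<times> real) \<Rightarrow>\<^sub>C 'b" and i t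
  have Scont: "continuous_on {0..T} (S w i)" for w i
    unfolding S_def
    by (intro continuous_intros \<Phi>cont continuous_on_compose2[OF continuous_on_apply_bcontfun[of UNIV w]]) auto
  define J where "J w i t = z0 i + integral {0..t} (\<lambda>s. F i s (\<lambda>j. S w j s))" for w i t
  have Fint: "(\<lambda>s. F i s (\<lambda>j. S w j s)) integrable_on {0..T}" if "i \<in> I" for w i
    using int[of "S w" i] Scont that by blast
  have Jcont: "continuous_on {0..T} (J w i)" if "i \<in> I" for w i
    unfolding J_def by (intro continuous_intros indefinite_integral_continuous_1 Fint that)
  define G where "G w = emb (\<lambda>i t. exp (- (2 * \<Phi> t)) *\<^sub>R J w i t)" for w
  have G: "apply_bcontfun (G w) (i, t) = (if i \<in> I then exp (- (2 * \<Phi> (p t))) *\<^sub>R J w i (p t) else 0)" for w i t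
    unfolding G_def by (rule emb) (intro continuous_intros \<Phi>cont Jcont)
  have \<Phi>pos: "0 \<le> \<Phi> t" if "t \<in> {0..T}" for t
    unfolding \<Phi>_def using that by (intro integral_nonneg integrable_subinterval_real[OF Li] Lpos) auto
  have contr: "dist (G w) (G w') \<le> 1 / 2 * dist w w'" for w w'
  proof (rule dist_bound)
    fix it :: "nat \<times> real"
    obtain i t' where it: "it = (i, t')" by (cases it)
    define t where "t = p t'"
    have t: "t \<in> {0..T}" using p by (simp add: t_def)
    show "dist (apply_bcontfun (G w) it) (apply_bcontfun (G w') it) \<le> 1 / 2 * dist w w'"
    proof (cases "i \<in> I")
      case False then show ?thesis by (simp add: it G)
    next
      case True
      define D where "D = dist w w'"
      have D: "D \<ge> 0" by (simp add: D_def)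
      have sub: "g integrable_on {0..t}" if "g integrable_on {0..T}" for g :: "real \<Rightarrow> 'b"
        using integrable_subinterval_real[OF that, of 0 t] t by auto
      have W: "((\<lambda>s. L s * exp (2 * \<Phi> s)) has_integral (exp (2 * \<Phi> t) - 1) / 2) {0..t}"
        unfolding \<Phi>_def by (rule has_integral_exp_indefinite_integral[OF L Lpos t])
      have W': "((\<lambda>s. L s * (exp (2 * \<Phi> s) * D)) has_integral (exp (2 * \<Phi> t) - 1) / 2 * D) {0..t}"
        using has_integral_mult_left[OF W, of D] by (simp add: mult_ac)
      have "J w i t - J w' i t = integral {0..t} (\<lambda>s. F i s (\<lambda>j. S w j s) - F i s (\<lambda>j. S w' j s))"
        unfolding J_def using integral_diff[OF sub[OF Fint[OF True, of w]] sub[OF Fint[OF True, of w']]] by simp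
      also have "norm \<dots> \<le> integral {0..t} (\<lambda>s. L s * (exp (2 * \<Phi> s) * D))"
      proof (rule Henstock_Kurzweil_Integration.integral_norm_bound_integral)
        show "(\<lambda>s. F i s (\<lambda>j. S w j s) - F i s (\<lambda>j. S w' j s)) integrable_on {0..t}"
          by (intro integrable_diff sub Fint True)
        show "(\<lambda>s. L s * (exp (2 * \<Phi> s) * D)) integrable_on {0..t}" using W' by blast
        fix s assume "s \<in> {0..t}"
        then have s: "s \<in> {0..T}" using t by auto
        show "norm (F i s (\<lambda>j. S w j s) - F i s (\<lambda>j. S w' j s)) \<le> L s * (exp (2 * \<Phi> s) * D)"
        proof (rule lip[OF True s])
          fix j
          have "norm (S w j s - S w' j s) = exp (2 * \<Phi> s) * dist (apply_bcontfun w (j, s)) (apply_bcontfun w' (j, s))"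
            by (simp add: S_def dist_norm flip: scaleR_diff_right)
          also have "\<dots> \<le> exp (2 * \<Phi> s) * D"
            unfolding D_def by (intro mult_left_mono dist_bounded) auto
          finally show "norm (S w j s - S w' j s) \<le> exp (2 * \<Phi> s) * D" .
        qed
      qed
      also have "\<dots> = (exp (2 * \<Phi> t) - 1) / 2 * D" using W' by (rule integral_unique)
      also have "\<dots> \<le> exp (2 * \<Phi> t) / 2 * D" using D by (intro mult_right_mono) auto
      finally have "exp (- (2 * \<Phi> t)) * norm (J w i t - J w' i t) \<le> exp (- (2 * \<Phi> t)) * (exp (2 * \<Phi> t) / 2 * D)"
        by (intro mult_left_mono) auto
      also have "\<dots> = (exp (- (2 * \<Phi> t)) * exp (2 * \<Phi> t)) / 2 * D" by simp
      also have "\<dots> = 1 / 2 * D" by (simp flip: exp_add)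
      finally show ?thesis
        using True by (simp add: it G D_def dist_norm flip: scaleR_diff_right t_def)
    qed
  qed
  have "\<exists>!w. G w = w"
    using Banach_fix[OF complete_UNIV_bcontfun UNIV_not_empty, of "1 / 2" G] contr by auto
  then obtain w where w: "G w = w" and w_unique: "\<And>w'. G w' = w' \<Longrightarrow> w' = w" by metis
  have SJ: "S w i t = J w i t" if "i \<in> I" "t \<in> {0..T}" for i t
  proof -
    have "S w i t = exp (2 * \<Phi> t) *\<^sub>R apply_bcontfun (G w) (i, t)" by (simp add: S_def w)
    also have "\<dots> = (exp (2 * \<Phi> t) * exp (- (2 * \<Phi> t))) *\<^sub>R J w i t" using that p by (simp add: G)
    also have "\<dots> = J w i t" by (simp flip: exp_add)
    finally show ?thesis .
  qed
  show thesis
  proof (rule that[of "S w"])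
    show "continuous_on {0..T} (S w i)" for i by (rule Scont)
    show "((\<lambda>s. F i s (\<lambda>j. S w j s)) has_integral (S w i t - z0 i)) {0..t}" if "i \<in> I" "t \<in> {0..T}" for i t
      using integrable_subinterval_real[OF Fint[OF that(1), of w], of 0 t] that(2)
      by (simp add: SJ[OF that] J_def integrable_integral)
    fix z' i t
    assume z'cont: "\<And>i. i \<in> I \<Longrightarrow> continuous_on {0..T} (z' i)"
      and z': "\<And>i t. \<lbrakk>i \<in> I; t \<in> {0..T}\<rbrakk> \<Longrightarrow> ((\<lambda>s. F i s (\<lambda>j. z' j s)) has_integral (z' i t - z0 i)) {0..t}"
      and it: "i \<in> I" "t \<in> {0..T}"
    \<comment> \<open>Weighting a competing solution turns it into another fixed point of
      \<open>G\<close>.\<close>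
    define w' where "w' = emb (\<lambda>i t. exp (- (2 * \<Phi> t)) *\<^sub>R z' i t)"
    have w': "apply_bcontfun w' (i, t) = (if i \<in> I then exp (- (2 * \<Phi> (p t))) *\<^sub>R z' i (p t) else 0)" for i t
      unfolding w'_def by (rule emb) (intro continuous_intros \<Phi>cont z'cont)
    have Sw': "S w' j s = z' j s" if "j \<in> I" "s \<in> {0..T}" for j s
      using that p by (simp add: S_def w' flip: exp_add)
    have "J w' j s = z' j s" if js: "j \<in> I" "s \<in> {0..T}" for j s
    proof -
      \<comment> \<open>\<open>S w'\<close> and \<open>z'\<close> agree only for indices in
        \<open>I\<close>. The Lipschitz condition with \<open>K = 0\<close> shows that
        \<open>F\<close> does not see the other components.\<close>
      have "F j r (\<lambda>k. S w' k r) = F j r (\<lambda>k. z' k r)" if "r \<in> {0..s}" for r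
        using lip[of j r "\<lambda>k. S w' k r" "\<lambda>k. z' k r" 0] that js Sw' by auto
      then have "integral {0..s} (\<lambda>r. F j r (\<lambda>k. S w' k r)) = integral {0..s} (\<lambda>r. F j r (\<lambda>k. z' k r))"
        by (intro integral_cong)
      then show ?thesis using integral_unique[OF z'[OF js]] by (simp add: J_def)
    qed
    then have "G w' = w'"
      using p(1) by (intro bcontfun_eqI) (auto simp: G w' split_paired_all)
    then have "w' = w" by (rule w_unique)
    then show "z' i t = S w i t" using Sw'[OF it] by simp
  qed
qed

section \<open>A priori bounds\<close>

text \<open>On a bounded interval the integrable function \<open>1 + (norm (u t))\<^sup>2\<close>
  dominates \<open>norm (u t)\<close>.\<close>

lemma L2_imp_absolutely_integrable:
  fixes u :: "real \<Rightarrow> 'a::euclidean_space"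
  assumes meas: "set_borel_measurable lborel {0..T} u"
    and L2: "set_integrable lborel {0..T} (\<lambda>t. (norm (u t))\<^sup>2)"
  shows "u absolutely_integrable_on {0..T}"
proof -
  have one: "set_integrable lborel {0..T} (\<lambda>t. 1 :: real)"
    by (rule borel_integrable_atLeastAtMost') simp
  have "set_integrable lborel {0..T} (\<lambda>t. 1 + (norm (u t))\<^sup>2)"
    by (rule set_integral_add[OF one L2])
  then have "set_integrable lborel {0..T} u"
    unfolding set_integrable_def
  proof (rule Bochner_Integration.integrable_bound)
    show "(\<lambda>x. indicat_real {0..T} x *\<^sub>R u x) \<in> borel_measurable lborel"
      using meas by (simp add: set_borel_measurable_def)
    have "norm (u t) \<le> 1 + (norm (u t))\<^sup>2" for t
    proof -
      have "0 \<le> (norm (u t) - 1 / 2)\<^sup>2" by simp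
      then show ?thesis by (simp add: power2_eq_square algebra_simps)
    qed
    then show "AE x in lborel. norm (indicat_real {0..T} x *\<^sub>R u x) \<le> norm (indicat_real {0..T} x *\<^sub>R (1 + (norm (u x))\<^sup>2))"
      by (intro AE_I2) (simp add: indicator_def)
  qed
  then show ?thesis
    unfolding set_integrable_def using integrable_completion borel_measurable_integrable by blast
qed

text \<open>Cauchy-Schwarz against the constant 1, obtained by integrating the square of
  \<open>norm (u t) - k\<close>. It turns the L1 norm of a control into the
  \<open>M * sqrt T\<close> of the statement.\<close>

lemma integral_norm_le_L2_norm_on:
  fixes u :: "real \<Rightarrow> 'a::euclidean_space"
  assumes T: "T > 0" and meas: "set_borel_measurable lborel {0..T} u"
    and L2: "set_integrable lborel {0..T} (\<lambda>t. (norm (u t))\<^sup>2)"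
  shows "integral {0..T} (\<lambda>t. norm (u t)) \<le> sqrt T * L2_norm_on T u"
proof -
  have L2i: "(\<lambda>t. (norm (u t))\<^sup>2) integrable_on {0..T}"
    and L2eq: "(LINT t:{0..T}|lborel. (norm (u t))\<^sup>2) = integral {0..T} (\<lambda>t. (norm (u t))\<^sup>2)"
    using set_borel_integral_eq_integral[OF L2] by auto
  have ui: "(\<lambda>t. norm (u t)) integrable_on {0..T}"
    using L2_imp_absolutely_integrable[OF meas L2] by (simp add: absolutely_integrable_on_def)
  define A where "A = integral {0..T} (\<lambda>t. norm (u t))"
  define B where "B = integral {0..T} (\<lambda>t. (norm (u t))\<^sup>2)"
  \<comment> \<open>The mean value of \<open>norm (u t)\<close>, which minimises the quadratic
    polynomial in \<open>k\<close> below.\<close>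
  define k where "k = A / T"
  have "((\<lambda>t. (norm (u t))\<^sup>2 - 2 * k * norm (u t) + k\<^sup>2) has_integral (B - 2 * k * A + k\<^sup>2 * T)) {0..T}"
    using has_integral_add[OF has_integral_diff[OF integrable_integral[OF L2i] has_integral_mult_right[OF integrable_integral[OF ui]]]
      has_integral_const_real[of "k\<^sup>2" 0 T], of "2 * k"] T
    by (simp add: A_def B_def mult.commute)
  then have "0 \<le> B - 2 * k * A + k\<^sup>2 * T"
  proof (rule has_integral_nonneg)
    fix t show "0 \<le> (norm (u t))\<^sup>2 - 2 * k * norm (u t) + k\<^sup>2"
      using zero_le_power2[of "norm (u t) - k"] by (simp add: power2_eq_square algebra_simps)
  qed
  then have "A\<^sup>2 \<le> T * B" using T by (simp add: k_def power2_eq_square field_simps)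
  then have "A \<le> sqrt (T * B)" by (rule real_le_rsqrt)
  then show ?thesis by (simp add: A_def B_def L2_norm_on_def L2eq real_sqrt_mult)
qed

section \<open>Invariance of the sphere and the velocity estimate\<close>

text \<open>The coupling and control terms are projected orthogonally to the position and drop out.
  The remaining \<open>- (norm (v i t))\<^sup>2\<close> cancels against the square of the velocity
  that appears when the inner product of position and velocity is differentiated.\<close>

lemma inner_position_vel_rhs:
  assumes "x i t \<noteq> 0"
  shows "x i t \<bullet> vel_rhs m \<gamma> \<kappa> N u x v i t = - (norm (v i t))\<^sup>2 - \<gamma> / m * (x i t \<bullet> v i t)"
proof -
  have "x i t \<bullet> (x j t - ((x i t \<bullet> x j t) / (norm (x i t))\<^sup>2) *\<^sub>R x i t) = 0" for j
    using assms by (simp add: inner_diff_right power2_norm_eq_inner)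
  moreover have "x i t \<bullet> (u i t - ((u i t \<bullet> x i t) / (norm (x i t))\<^sup>2) *\<^sub>R x i t) = 0"
    using assms by (simp add: inner_diff_right power2_norm_eq_inner inner_commute)
  ultimately show ?thesis
    using assms unfolding vel_rhs_def
    by (simp add: inner_add_right inner_diff_right inner_sum_right power2_norm_eq_inner)
qed

text \<open>Tangency kills every multiple of the position, friction has a favourable sign, and each
  of the \<open>N\<close> unit vectors contributes at most \<open>norm (v i t)\<close>, which
  compensates the factor \<open>1 / N\<close>.\<close>

lemma inner_velocity_vel_rhs_le:
  assumes "N \<ge> 1" "m > 0" "\<gamma> > 0" "\<kappa> \<ge> 0" and sphere: "\<And>j. j \<in> {1..N} \<Longrightarrow> norm (x j t) = 1"
    and i: "i \<in> {1..N}" and tangent: "x i t \<bullet> v i t = 0"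
  shows "v i t \<bullet> vel_rhs m \<gamma> \<kappa> N u x v i t \<le> norm (v i t) * (\<kappa> / m + norm (u i t))"
proof -
  have vx: "v i t \<bullet> x i t = 0" using tangent by (simp add: inner_commute)
  have "v i t \<bullet> vel_rhs m \<gamma> \<kappa> N u x v i t
     = - (\<gamma> / m * (v i t \<bullet> v i t)) + \<kappa> / (m * real N) * (\<Sum>j\<in>{1..N}. v i t \<bullet> x j t) + v i t \<bullet> u i t"
    unfolding vel_rhs_def
    by (simp add: inner_add_right inner_diff_right inner_sum_right vx)
  moreover have "0 \<le> \<gamma> / m * (v i t \<bullet> v i t)" using assms by simp
  moreover have "\<kappa> / (m * real N) * (\<Sum>j\<in>{1..N}. v i t \<bullet> x j t) \<le> \<kappa> / (m * real N) * (\<Sum>j\<in>{1..N}. norm (v i t))"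
  proof (intro mult_left_mono sum_mono)
    fix j assume "j \<in> {1..N}"
    then show "v i t \<bullet> x j t \<le> norm (v i t)"
      using norm_cauchy_schwarz[of "v i t" "x j t"] sphere by simp
  qed (use assms in auto)
  moreover have "\<kappa> / (m * real N) * (\<Sum>j\<in>{1..N}. norm (v i t)) = norm (v i t) * (\<kappa> / m)"
    using assms by simp
  moreover have "v i t \<bullet> u i t \<le> norm (v i t) * norm (u i t)" by (rule norm_cauchy_schwarz)
  ultimately show ?thesis by (simp add: distrib_left)
qed

lemma solution_sphere_tangent:
  assumes sol: "is_solution m \<gamma> \<kappa> N T u x0 v0 x v" and "m > 0" "\<gamma> > 0"
    and x0: "norm (x0 i) = 1" and v0: "x0 i \<bullet> v0 i = 0"
    and i: "i \<in> {1..N}" and t: "t \<in> {0..T}"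
  shows "norm (x i t) = 1" and "x i t \<bullet> v i t = 0"
proof -
  define b where "b s = x i s \<bullet> v i s" for s
  have X: "abs_continuous_on 0 T (x i)" and V: "abs_continuous_on 0 T (v i)"
    and init: "x i 0 = x0 i" "v i 0 = v0 i" and nz: "\<And>t. t \<in> {0..T} \<Longrightarrow> x i t \<noteq> 0"
    and ode: "AE t in lborel. t \<in> {0..T} \<longrightarrow>
            (x i has_vector_derivative v i t) (at t) \<and>
            (v i has_vector_derivative vel_rhs m \<gamma> \<kappa> N u x v i t) (at t)"
    using sol i unfolding is_solution_def by blast+
  have b_ac: "abs_continuous_on 0 T b"
    unfolding b_def using abs_continuous_on_bilinear[OF bounded_bilinear_inner X V] .
  have b_zero: "b t = 0" if t: "t \<in> {0..T}" for t
  proof -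
    \<comment> \<open>The square of \<open>b\<close> has a nonpositive derivative a.e. and starts at
      zero, so no integrating factor is called for.\<close>
    have "abs_continuous_on 0 t (\<lambda>s. b s * b s)"
      using abs_continuous_on_bilinear[OF bounded_bilinear_mult b_ac b_ac] t
      by (auto intro: abs_continuous_on_subinterval)
    moreover have "AE s in lborel. s \<in> {0..t} \<longrightarrow>
        ((\<lambda>s. b s * b s) has_vector_derivative - (2 * (\<gamma> / m)) * (b s * b s)) (at s within {0..t})"
      using ode
    proof (rule AE_mp, intro AE_I2 impI)
      fix s assume ode: "s \<in> {0..T} \<longrightarrow> (x i has_vector_derivative v i s) (at s) \<and>
            (v i has_vector_derivative vel_rhs m \<gamma> \<kappa> N u x v i s) (at s)" and s: "s \<in> {0..t}"
      then have s': "s \<in> {0..T}" using t by auto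
      have "(b has_vector_derivative (x i s \<bullet> vel_rhs m \<gamma> \<kappa> N u x v i s + v i s \<bullet> v i s)) (at s)"
        unfolding b_def using ode s' by (intro bounded_bilinear.has_vector_derivative[OF bounded_bilinear_inner]) auto
      then have "(b has_vector_derivative - (\<gamma> / m) * b s) (at s)"
        by (simp add: inner_position_vel_rhs nz[OF s'] b_def power2_norm_eq_inner)
      then have "(b has_vector_derivative - (\<gamma> / m) * b s) (at s within {0..t})"
        by (rule has_vector_derivative_at_within)
      from bounded_bilinear.has_vector_derivative[OF bounded_bilinear_mult this this]
      show "((\<lambda>s. b s * b s) has_vector_derivative - (2 * (\<gamma> / m)) * (b s * b s)) (at s within {0..t})"
        by (simp add: algebra_simps)
    qed
    ultimately have "((\<lambda>s. - (2 * (\<gamma> / m)) * (b s * b s)) has_integral (b t * b t - b 0 * b 0)) {0..t}"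
      using t by (intro abs_continuous_on_has_integral) auto
    then have "b t * b t - b 0 * b 0 \<le> 0"
      by (rule has_integral_le[OF _ has_integral_0]) (use assms in \<open>simp add: mult_nonneg_nonneg\<close>)
    moreover have "b 0 = 0" using v0 by (simp add: b_def init)
    ultimately have "b t * b t \<le> 0" by simp
    then show ?thesis using not_square_less_zero[of "b t"] by (metis linorder_not_less mult_eq_0_iff order_antisym)
  qed
  \<comment> \<open>The derivative of the squared norm of the position is \<open>2 * b\<close>,
    which has just been shown to vanish.\<close>
  have "abs_continuous_on 0 t (\<lambda>s. x i s \<bullet> x i s)"
    using abs_continuous_on_bilinear[OF bounded_bilinear_inner X X] t
    by (auto intro: abs_continuous_on_subinterval)
  moreover have "AE s in lborel. s \<in> {0..t} \<longrightarrow>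
      ((\<lambda>s. x i s \<bullet> x i s) has_vector_derivative 0) (at s within {0..t})"
    using ode
  proof (rule AE_mp, intro AE_I2 impI)
    fix s assume ode: "s \<in> {0..T} \<longrightarrow> (x i has_vector_derivative v i s) (at s) \<and>
          (v i has_vector_derivative vel_rhs m \<gamma> \<kappa> N u x v i s) (at s)" and s: "s \<in> {0..t}"
    then have s': "s \<in> {0..T}" using t by auto
    have d: "(x i has_vector_derivative v i s) (at s within {0..t})"
      using ode s' has_vector_derivative_at_within by blast
    from bounded_bilinear.has_vector_derivative[OF bounded_bilinear_inner d d]
    show "((\<lambda>s. x i s \<bullet> x i s) has_vector_derivative 0) (at s within {0..t})"
      using b_zero[OF s'] by (simp add: b_def inner_commute)
  qed
  ultimately have "((\<lambda>s. 0) has_integral (x i t \<bullet> x i t - x i 0 \<bullet> x i 0)) {0..t}"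
    using t by (intro abs_continuous_on_has_integral) auto
  then have "x i t \<bullet> x i t = 1"
    using x0 has_integral_0_eq by (fastforce simp: init norm_eq_1)
  then show "norm (x i t) = 1" by (simp add: norm_eq_1)
  show "x i t \<bullet> v i t = 0" using b_zero[OF t] by (simp add: b_def)
qed

lemma solution_velocity_bound:
  assumes sol: "is_solution m \<gamma> \<kappa> N T u x0 v0 x v"
    and "N \<ge> 1" "m > 0" "\<gamma> > 0" "\<kappa> \<ge> 0"
    and x0: "\<And>j. j \<in> {1..N} \<Longrightarrow> norm (x0 j) = 1" and v0: "\<And>j. j \<in> {1..N} \<Longrightarrow> x0 j \<bullet> v0 j = 0"
    and i: "i \<in> {1..N}" and u: "(\<lambda>t. norm (u i t)) integrable_on {0..T}" and t: "t \<in> {0..T}"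
  shows "norm (v i t) \<le> norm (v0 i) + 2 * \<kappa> * T / m + 2 * integral {0..T} (\<lambda>t. norm (u i t))"
proof -
  have sphere: "norm (x j s) = 1" "x j s \<bullet> v j s = 0" if "j \<in> {1..N}" "s \<in> {0..T}" for j s
    using solution_sphere_tangent[OF sol \<open>m > 0\<close> \<open>\<gamma> > 0\<close> x0 v0] that by auto
  have V: "abs_continuous_on 0 T (v i)" and init: "v i 0 = v0 i"
    and ode: "AE t in lborel. t \<in> {0..T} \<longrightarrow>
            (x i has_vector_derivative v i t) (at t) \<and>
            (v i has_vector_derivative vel_rhs m \<gamma> \<kappa> N u x v i t) (at t)"
    using sol i unfolding is_solution_def by blast+
  have "continuous_on {0..T} (\<lambda>t. norm (v i t))"
    by (intro continuous_intros abs_continuous_on_imp_continuous_on V)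
  \<comment> \<open>Integrating the squared speed up to a time of maximal speed avoids
    differentiating the norm where the velocity vanishes.\<close>
  then obtain r where r: "r \<in> {0..T}" and r_max: "\<And>s. s \<in> {0..T} \<Longrightarrow> norm (v i s) \<le> norm (v i r)"
    using continuous_attains_sup[of "{0..T}" "\<lambda>t. norm (v i t)"] t by auto
  define S where "S = norm (v i r)"
  define H where "H = \<kappa> / m * T + integral {0..T} (\<lambda>t. norm (u i t))"
  have S: "S \<ge> 0" by (simp add: S_def)
  have "abs_continuous_on 0 r (\<lambda>s. v i s \<bullet> v i s)"
    using abs_continuous_on_bilinear[OF bounded_bilinear_inner V V] r
    by (auto intro: abs_continuous_on_subinterval)
  moreover have "AE s in lborel. s \<in> {0..r} \<longrightarrow>
      ((\<lambda>s. v i s \<bullet> v i s) has_vector_derivative 2 * (v i s \<bullet> vel_rhs m \<gamma> \<kappa> N u x v i s)) (at s within {0..r})"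
    using ode
  proof (rule AE_mp, intro AE_I2 impI)
    fix s assume ode: "s \<in> {0..T} \<longrightarrow> (x i has_vector_derivative v i s) (at s) \<and>
          (v i has_vector_derivative vel_rhs m \<gamma> \<kappa> N u x v i s) (at s)" and s: "s \<in> {0..r}"
    then have d: "(v i has_vector_derivative vel_rhs m \<gamma> \<kappa> N u x v i s) (at s within {0..r})"
      using r by (auto intro: has_vector_derivative_at_within)
    from bounded_bilinear.has_vector_derivative[OF bounded_bilinear_inner d d]
    show "((\<lambda>s. v i s \<bullet> v i s) has_vector_derivative 2 * (v i s \<bullet> vel_rhs m \<gamma> \<kappa> N u x v i s)) (at s within {0..r})"
      by (simp add: inner_commute)
  qed
  ultimately have lhs: "((\<lambda>s. 2 * (v i s \<bullet> vel_rhs m \<gamma> \<kappa> N u x v i s)) has_integral (v i r \<bullet> v i r - v i 0 \<bullet> v i 0)) {0..r}"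
    using r by (intro abs_continuous_on_has_integral) auto
  have ur: "(\<lambda>t. norm (u i t)) integrable_on {0..r}"
    using integrable_subinterval_real[OF u, of 0 r] r by auto
  have rhs: "((\<lambda>s. 2 * S * (\<kappa> / m + norm (u i s))) has_integral 2 * S * (\<kappa> / m * r + integral {0..r} (\<lambda>t. norm (u i t)))) {0..r}"
    using has_integral_mult_right[OF has_integral_add[OF has_integral_const_real[of "\<kappa> / m" 0 r] integrable_integral[OF ur]], of "2 * S"] r
    by (simp add: mult.commute)
  have "v i r \<bullet> v i r - v i 0 \<bullet> v i 0 \<le> 2 * S * (\<kappa> / m * r + integral {0..r} (\<lambda>t. norm (u i t)))"
  proof (rule has_integral_le[OF lhs rhs])
    fix s assume "s \<in> {0..r}"
    then have s: "s \<in> {0..T}" using r by auto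
    have "v i s \<bullet> vel_rhs m \<gamma> \<kappa> N u x v i s \<le> norm (v i s) * (\<kappa> / m + norm (u i s))"
      using assms sphere s by (intro inner_velocity_vel_rhs_le) auto
    also have "\<dots> \<le> S * (\<kappa> / m + norm (u i s))"
      using r_max[OF s] assms by (intro mult_right_mono) (auto simp: S_def)
    finally show "2 * (v i s \<bullet> vel_rhs m \<gamma> \<kappa> N u x v i s) \<le> 2 * S * (\<kappa> / m + norm (u i s))" by simp
  qed
  also have "\<dots> \<le> 2 * S * H"
    unfolding H_def using S r assms
    by (intro mult_left_mono add_mono integral_subset_le ur u) auto
  finally have "S * S \<le> norm (v0 i) * norm (v0 i) + 2 * S * H"
    by (simp add: S_def init power2_norm_eq_inner flip: power2_eq_square)
  \<comment> \<open>Time 0 competes for the maximum, so one factor of the squared initial speed can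
    be replaced by \<open>S\<close>. Every term then carries a factor \<open>S\<close>, which is
    cancelled; in the case \<open>S = 0\<close> nonnegativity of the bound suffices.\<close>
  moreover have "norm (v0 i) \<le> S" using r_max[of 0] r by (simp add: S_def init)
  then have "norm (v0 i) * norm (v0 i) \<le> norm (v0 i) * S" by (intro mult_left_mono) auto
  ultimately have "S * S \<le> (norm (v0 i) + 2 * H) * S" by (simp add: algebra_simps)
  moreover have "0 \<le> norm (v0 i) + 2 * H"
    unfolding H_def using assms t u by (intro add_nonneg_nonneg mult_nonneg_nonneg integral_nonneg) auto
  ultimately have "S \<le> norm (v0 i) + 2 * H"
    using S by (metis mult_le_cancel_right order_le_less)
  then show ?thesis using r_max[OF t] by (simp add: S_def H_def algebra_simps)
qed

section \<open>The truncated system\<close>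

text \<open>Bridge from the integral form produced by the fixed point to the Caratheodory form,
  using the two facts on indefinite integrals proved above.\<close>

lemma integral_equation_imp_solution:
  fixes f w :: "real \<Rightarrow> 'a::euclidean_space"
  assumes f: "f absolutely_integrable_on {0..T}" and T: "0 \<le> T"
    and w: "\<And>t. t \<in> {0..T} \<Longrightarrow> (f has_integral (w t - w0)) {0..t}"
  shows "abs_continuous_on 0 T w" "w 0 = w0"
    "AE t in lborel. t \<in> {0..T} \<longrightarrow> (w has_vector_derivative f t) (at t)"
proof -
  have w_eq: "w t = w0 + integral {0..t} f" if "t \<in> {0..T}" for t
    using integral_unique[OF w[OF that]] by simp
  have ac: "abs_continuous_on 0 T (\<lambda>t. integral {0..t} f)" by (rule abs_continuous_on_integral[OF f])
  show "abs_continuous_on 0 T w"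
    by (rule abs_continuous_on_dominated[OF ac ac, where C = 1]) (simp add: w_eq)
  show "w 0 = w0" using w_eq[of 0] T by simp
  have fi: "f integrable_on {0..T}" using f set_lebesgue_integral_eq_integral(1) by blast
  \<comment> \<open>The solution concept asks for two-sided derivatives. At the endpoints only
    one-sided ones are available, so these two points are put into the null set.\<close>
  have "AE t in lborel. t \<noteq> 0 \<and> t \<noteq> T"
    using AE_lborel_singleton[of "0::real"] AE_lborel_singleton[of T] by eventually_elim simp
  with AE_integral_has_vector_derivative[OF fi]
  show "AE t in lborel. t \<in> {0..T} \<longrightarrow> (w has_vector_derivative f t) (at t)"
  proof eventually_elim
    case (elim t)
    show ?case
    proof
      assume t: "t \<in> {0..T}"
      then have "((\<lambda>t. w0 + integral {0..t} f) has_vector_derivative f t) (at t within {0..T})"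
        using elim by (auto intro!: derivative_eq_intros)
      then have "(w has_vector_derivative f t) (at t within {0..T})"
        using has_vector_derivative_transform[OF t, of w "\<lambda>t. w0 + integral {0..t} f"] w_eq by blast
      moreover have "at t within {0..T} = at t"
        using elim t by (intro at_within_Icc_at) auto
      ultimately show "(w has_vector_derivative f t) (at t)" by simp
    qed
  qed
qed

section \<open>Lipschitz cut-offs\<close>

text \<open>Encoded as the projection onto a closed convex set, so that the Lipschitz constant 1 is
  inherited from closest points.\<close>

definition clip :: "real \<Rightarrow> 'a::euclidean_space \<Rightarrow> 'a" where
  "clip R x = closest_point (cball 0 R) x"

lemma clip_eq: "norm x \<le> R \<Longrightarrow> clip R x = x"
  by (simp add: clip_def closest_point_self)

lemma norm_clip_le: "R \<ge> 0 \<Longrightarrow> norm (clip R x) \<le> R"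
  using closest_point_in_set[of "cball 0 R" x] by (simp add: clip_def)

lemma norm_clip_diff_le: "R \<ge> 0 \<Longrightarrow> norm (clip R x - clip R y) \<le> norm (x - y)"
  using closest_point_lipschitz[of "cball 0 R" x y] by (simp add: clip_def dist_norm)

lemma continuous_on_clip:
  assumes "R \<ge> 0" "continuous_on S f"
  shows "continuous_on S (\<lambda>t. clip R (f t))"
proof -
  have "continuous_on UNIV (clip R :: 'b \<Rightarrow> 'b)"
    unfolding clip_def[abs_def] using assms(1) by (intro continuous_on_closest_point) auto
  then show ?thesis by (rule continuous_on_compose2[OF _ assms(2)]) auto
qed

text \<open>The cut-off \<open>1 / 4\<close> makes \<open>x \<mapsto> x / \<parallel>x\<parallel>\<^sup>2\<close> Lipschitz near \<open>0\<close> and is inactive for \<open>\<parallel>x\<parallel> \<ge> 1 / 2\<close>.\<close>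

definition clipped_inversion :: "'a::euclidean_space \<Rightarrow> 'a" where
  "clipped_inversion x = (1 / max (1 / 4) ((norm x)\<^sup>2)) *\<^sub>R x"

lemma clipped_inversion_eq:
  assumes "1 / 2 \<le> norm x"
  shows "clipped_inversion x = (1 / (norm x)\<^sup>2) *\<^sub>R x"
proof -
  have "(1 / 2)\<^sup>2 \<le> (norm x)\<^sup>2" using assms by (intro power_mono) auto
  then show ?thesis by (simp add: clipped_inversion_def power2_eq_square max_def)
qed

lemma norm_scaleR_diff_le:
  fixes y y' :: "'a::real_normed_vector"
  shows "norm (a *\<^sub>R y - a' *\<^sub>R y') \<le> \<bar>a - a'\<bar> * norm y + \<bar>a'\<bar> * norm (y - y')"
proof -
  have "a *\<^sub>R y - a' *\<^sub>R y' = (a - a') *\<^sub>R y + a' *\<^sub>R (y - y')" by (simp add: algebra_simps)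
  then show ?thesis using norm_triangle_ineq[of "(a - a') *\<^sub>R y" "a' *\<^sub>R (y - y')"] by simp
qed

lemma abs_norm_power2_diff_le:
  fixes x y :: "'a::real_normed_vector"
  assumes "norm x \<le> R" "norm y \<le> R"
  shows "\<bar>(norm x)\<^sup>2 - (norm y)\<^sup>2\<bar> \<le> 2 * R * norm (x - y)"
proof -
  have "\<bar>(norm x)\<^sup>2 - (norm y)\<^sup>2\<bar> = (norm x + norm y) * \<bar>norm x - norm y\<bar>"
    by (simp add: power2_eq_square square_diff_square_factored abs_mult)
  also have "\<dots> \<le> (2 * R) * norm (x - y)"
    using assms order_trans[OF norm_ge_zero assms(1)] by (intro mult_mono norm_triangle_ineq3) auto
  finally show ?thesis .
qed

lemma norm_clipped_inversion_le:
  assumes "norm x \<le> 2"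
  shows "norm (clipped_inversion x) \<le> 8"
proof -
  have "1 / max (1 / 4) ((norm x)\<^sup>2) \<le> 1 / (1 / 4)" by (intro divide_left_mono) auto
  then have "1 / max (1 / 4) ((norm x)\<^sup>2) * norm x \<le> 4 * 2" using assms by (intro mult_mono) auto
  then show ?thesis by (simp add: clipped_inversion_def)
qed

text \<open>On the ball of radius 2 the squared norm is 4-Lipschitz and both reciprocals are at most
  4, so the scalar factor is 64-Lipschitz. With the product rule this gives
  \<open>64 * 2 + 4 = 132\<close>.\<close>

lemma norm_clipped_inversion_diff_le:
  assumes x: "norm x \<le> 2" and y: "norm y \<le> 2"
  shows "norm (clipped_inversion x - clipped_inversion y) \<le> 132 * norm (x - y)"
proof -
  define p where "p = max (1 / 4) ((norm x)\<^sup>2)"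
  define q where "q = max (1 / 4) ((norm y)\<^sup>2)"
  have pq: "1 / 4 \<le> p" "1 / 4 \<le> q" by (auto simp: p_def q_def)
  have "\<bar>q - p\<bar> \<le> \<bar>(norm x)\<^sup>2 - (norm y)\<^sup>2\<bar>" by (auto simp: p_def q_def max_def)
  also have "\<dots> \<le> 4 * norm (x - y)" using abs_norm_power2_diff_le[OF x y] by simp
  finally have d: "\<bar>q - p\<bar> \<le> 4 * norm (x - y)" .
  have "1 / p - 1 / q = (q - p) * (1 / p * (1 / q))" using pq by (simp add: field_simps)
  then have "\<bar>1 / p - 1 / q\<bar> = \<bar>q - p\<bar> * (1 / p * (1 / q))" using pq by (simp add: abs_mult)
  also have "\<dots> \<le> (4 * norm (x - y)) * ((1 / (1 / 4)) * (1 / (1 / 4)))"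
    using pq d by (intro mult_mono divide_left_mono mult_nonneg_nonneg) auto
  finally have r: "\<bar>1 / p - 1 / q\<bar> \<le> 64 * norm (x - y)" by simp
  have q4: "\<bar>1 / q\<bar> \<le> 4" using pq by (simp add: field_simps)
  have "norm (clipped_inversion x - clipped_inversion y) \<le> \<bar>1 / p - 1 / q\<bar> * norm x + \<bar>1 / q\<bar> * norm (x - y)"
    unfolding clipped_inversion_def p_def q_def by (rule norm_scaleR_diff_le)
  also have "\<dots> \<le> (64 * norm (x - y)) * 2 + 4 * norm (x - y)"
    using r x q4 by (intro add_mono mult_mono) auto
  finally show ?thesis by simp
qed

lemma continuous_on_clipped_inversion:
  assumes "continuous_on S f"
  shows "continuous_on S (\<lambda>t. clipped_inversion (f t))"
proof -
  have "max (1 / 4) ((norm x)\<^sup>2) \<noteq> 0" for x :: 'b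
    using max.cobounded1[of "1 / 4" "(norm x)\<^sup>2"] by linarith
  then show ?thesis unfolding clipped_inversion_def by (intro continuous_intros assms ballI)
qed

text \<open>Positions are cut at radius 2 and the velocity at \<open>R\<close>, so every
  state-dependent factor is bounded as well as Lipschitz. The control is not cut; its size enters
  the time-dependent Lipschitz constant.\<close>

definition clipped_rhs ::
  "real \<Rightarrow> real \<Rightarrow> real \<Rightarrow> nat \<Rightarrow> real \<Rightarrow> (nat \<Rightarrow> real \<Rightarrow> 'a::euclidean_space) \<Rightarrow> nat \<Rightarrow> real \<Rightarrow> (nat \<Rightarrow> 'a \<times> 'a) \<Rightarrow> 'a" where
  "clipped_rhs m \<gamma> \<kappa> N R u i t z =
    (let X = \<lambda>j. clip 2 (fst (z j)); V = clip R (snd (z i)); Y = clipped_inversion (X i)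
     in - ((norm V)\<^sup>2 *\<^sub>R Y) - (\<gamma> / m) *\<^sub>R V
        + (\<kappa> / (m * real N)) *\<^sub>R (\<Sum>j\<in>{1..N}. X j - (X i \<bullet> X j) *\<^sub>R Y)
        + (u i t - (u i t \<bullet> X i) *\<^sub>R Y))"

lemma clipped_rhs_eq_vel_rhs:
  assumes "\<And>j. j \<in> {1..N} \<Longrightarrow> norm (x j t) \<le> 2" and "i \<in> {1..N}" and "1 / 2 \<le> norm (x i t)"
    and "norm (v i t) \<le> R"
  shows "clipped_rhs m \<gamma> \<kappa> N R u i t (\<lambda>j. (x j t, v j t)) = vel_rhs m \<gamma> \<kappa> N u x v i t"
proof -
  have "(\<Sum>j\<in>{1..N}. clip 2 (x j t) - (x i t \<bullet> clip 2 (x j t)) *\<^sub>R y)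
      = (\<Sum>j\<in>{1..N}. x j t - (x i t \<bullet> x j t) *\<^sub>R y)" for y
    using assms(1) by (intro sum.cong) (simp_all add: clip_eq)
  then show ?thesis
    using assms by (simp add: clipped_rhs_def vel_rhs_def Let_def clip_eq clipped_inversion_eq)
qed

text \<open>The nonlinear terms are scalars times \<open>Y\<close>, where \<open>Y\<close> is
  bounded by 8 and varies by at most \<open>132 * K\<close>. This yields
  \<open>16 * R + 132 * R\<^sup>2\<close> for the centripetal term,
  \<open>561 = 1 + 32 + 528\<close> for each coupling term and \<open>272 = 8 + 264\<close> per unit
  of control.\<close>

lemma norm_clipped_rhs_diff_le:
  fixes z z' :: "nat \<Rightarrow> 'a::euclidean_space \<times> 'a"
  assumes "N \<ge> 1" "m > 0" "\<gamma> > 0" "\<kappa> \<ge> 0" and R: "R \<ge> 0" and i: "i \<in> {1..N}"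
    and z: "\<And>j. j \<in> {1..N} \<Longrightarrow> norm (z j - z' j) \<le> K"
  shows "norm (clipped_rhs m \<gamma> \<kappa> N R u i t z - clipped_rhs m \<gamma> \<kappa> N R u i t z')
     \<le> (16 * R + 132 * R\<^sup>2 + \<gamma> / m + 561 * (\<kappa> / m) + 272 * norm (u i t)) * K"
proof -
  define X where "X j = clip 2 (fst (z j))" for j
  define X' where "X' j = clip 2 (fst (z' j))" for j
  define V where "V = clip R (snd (z i))"
  define V' where "V' = clip R (snd (z' i))"
  define Y where "Y = clipped_inversion (X i)"
  define Y' where "Y' = clipped_inversion (X' i)"
  have K: "K \<ge> 0" using z[OF i] norm_ge_zero order_trans by blast
  have X: "norm (X j) \<le> 2" "norm (X' j) \<le> 2" for j by (simp_all add: X_def X'_def norm_clip_le)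
  have XK: "norm (X j - X' j) \<le> K" if "j \<in> {1..N}" for j
  proof -
    have "norm (X j - X' j) \<le> norm (fst (z j - z' j))"
      unfolding X_def X'_def fst_diff by (intro norm_clip_diff_le) simp
    also have "\<dots> \<le> K" using norm_fst_le[of "fst (z j - z' j)" "snd (z j - z' j)", unfolded prod.collapse] z[OF that] by linarith
    finally show ?thesis .
  qed
  have V: "norm V \<le> R" "norm V' \<le> R" using R by (simp_all add: V_def V'_def norm_clip_le)
  have VK: "norm (V - V') \<le> K"
  proof -
    have "norm (V - V') \<le> norm (snd (z i - z' i))"
      unfolding V_def V'_def snd_diff by (intro norm_clip_diff_le R)
    also have "\<dots> \<le> K" using norm_snd_le[of "snd (z i - z' i)" "fst (z i - z' i)", unfolded prod.collapse] z[OF i] by linarith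
    finally show ?thesis .
  qed
  have Y: "norm Y \<le> 8" unfolding Y_def by (intro norm_clipped_inversion_le X)
  have YK: "norm (Y - Y') \<le> 132 * K"
  proof -
    have "norm (Y - Y') \<le> 132 * norm (X i - X' i)"
      unfolding Y_def Y'_def by (intro norm_clipped_inversion_diff_le X)
    then show ?thesis using XK[OF i] by linarith
  qed
  \<comment> \<open>Product rule in the form used for all three kinds of terms: \<open>d\<close>
    bounds the variation of the coefficient, \<open>b\<close> its size.\<close>
  have scale: "norm (a *\<^sub>R Y - a' *\<^sub>R Y') \<le> d * 8 + b * (132 * K)" if "\<bar>a - a'\<bar> \<le> d" "\<bar>a'\<bar> \<le> b" for a a' b d
  proof -
    have "norm (a *\<^sub>R Y - a' *\<^sub>R Y') \<le> \<bar>a - a'\<bar> * norm Y + \<bar>a'\<bar> * norm (Y - Y')"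
      by (rule norm_scaleR_diff_le)
    also have "\<dots> \<le> d * 8 + b * (132 * K)"
      using that Y YK by (intro add_mono mult_mono) auto
    finally show ?thesis .
  qed
  have 1: "norm ((norm V)\<^sup>2 *\<^sub>R Y - (norm V')\<^sup>2 *\<^sub>R Y') \<le> (2 * R * K) * 8 + R\<^sup>2 * (132 * K)"
  proof (rule scale)
    have "\<bar>(norm V)\<^sup>2 - (norm V')\<^sup>2\<bar> \<le> 2 * R * norm (V - V')" by (rule abs_norm_power2_diff_le[OF V])
    also have "\<dots> \<le> 2 * R * K" using VK R by (intro mult_left_mono) auto
    finally show "\<bar>(norm V)\<^sup>2 - (norm V')\<^sup>2\<bar> \<le> 2 * R * K" .
    show "\<bar>(norm V')\<^sup>2\<bar> \<le> R\<^sup>2" using V(2) by (simp add: power_mono)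
  qed
  have 2: "norm ((\<gamma> / m) *\<^sub>R V - (\<gamma> / m) *\<^sub>R V') \<le> \<gamma> / m * K"
    using VK assms by (simp flip: scaleR_diff_right add: mult_left_mono divide_right_mono)
  have 3: "norm ((X j - (X i \<bullet> X j) *\<^sub>R Y) - (X' j - (X' i \<bullet> X' j) *\<^sub>R Y')) \<le> 561 * K" if j: "j \<in> {1..N}" for j
  proof -
    have "X i \<bullet> X j - X' i \<bullet> X' j = (X i - X' i) \<bullet> X j + X' i \<bullet> (X j - X' j)"
      by (simp add: inner_diff_left inner_diff_right)
    also have "\<bar>\<dots>\<bar> \<le> norm (X i - X' i) * norm (X j) + norm (X' i) * norm (X j - X' j)"
      by (intro order_trans[OF abs_triangle_ineq] add_mono Cauchy_Schwarz_ineq2)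
    also have "\<dots> \<le> K * 2 + 2 * K"
      using X XK[OF i] XK[OF j] K by (intro add_mono mult_mono) auto
    finally have d: "\<bar>X i \<bullet> X j - X' i \<bullet> X' j\<bar> \<le> K * 2 + 2 * K" .
    have "\<bar>X' i \<bullet> X' j\<bar> \<le> norm (X' i) * norm (X' j)" by (rule Cauchy_Schwarz_ineq2)
    also have "\<dots> \<le> 2 * 2" using X by (intro mult_mono) auto
    finally have s: "norm ((X i \<bullet> X j) *\<^sub>R Y - (X' i \<bullet> X' j) *\<^sub>R Y') \<le> (K * 2 + 2 * K) * 8 + (2 * 2) * (132 * K)"
      by (intro scale d)
    have "norm ((X j - (X i \<bullet> X j) *\<^sub>R Y) - (X' j - (X' i \<bullet> X' j) *\<^sub>R Y'))
        = norm ((X j - X' j) - ((X i \<bullet> X j) *\<^sub>R Y - (X' i \<bullet> X' j) *\<^sub>R Y'))" by (simp add: algebra_simps)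
    also have "\<dots> \<le> K + ((K * 2 + 2 * K) * 8 + (2 * 2) * (132 * K))"
      by (rule norm_triangle_le_diff[OF add_mono[OF XK[OF j] s]])
    finally show ?thesis by simp
  qed
  define P where "P = (\<Sum>j\<in>{1..N}. X j - (X i \<bullet> X j) *\<^sub>R Y)"
  define P' where "P' = (\<Sum>j\<in>{1..N}. X' j - (X' i \<bullet> X' j) *\<^sub>R Y')"
  have "norm (P - P') \<le> (\<Sum>j\<in>{1..N}. 561 * K)"
    unfolding P_def P'_def sum_subtractf[symmetric] by (intro sum_norm_le 3)
  then have "\<kappa> / (m * real N) * norm (P - P') \<le> \<kappa> / (m * real N) * (real N * (561 * K))"
    using assms by (intro mult_left_mono) auto
  moreover have "\<kappa> / (m * real N) * (real N * (561 * K)) = 561 * (\<kappa> / m) * K"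
    using assms by (simp add: field_simps)
  moreover have "norm ((\<kappa> / (m * real N)) *\<^sub>R P - (\<kappa> / (m * real N)) *\<^sub>R P') = \<kappa> / (m * real N) * norm (P - P')"
    unfolding scaleR_diff_right[symmetric] norm_scaleR using assms by simp
  ultimately have 4: "norm ((\<kappa> / (m * real N)) *\<^sub>R P - (\<kappa> / (m * real N)) *\<^sub>R P') \<le> 561 * (\<kappa> / m) * K"
    by simp
  have 5: "norm ((u i t \<bullet> X i) *\<^sub>R Y - (u i t \<bullet> X' i) *\<^sub>R Y') \<le> (norm (u i t) * K) * 8 + (norm (u i t) * 2) * (132 * K)"
  proof (rule scale)
    have "\<bar>u i t \<bullet> X i - u i t \<bullet> X' i\<bar> \<le> norm (u i t) * norm (X i - X' i)"
      by (simp add: Cauchy_Schwarz_ineq2 flip: inner_diff_right)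
    also have "\<dots> \<le> norm (u i t) * K" using XK[OF i] by (intro mult_left_mono) auto
    finally show "\<bar>u i t \<bullet> X i - u i t \<bullet> X' i\<bar> \<le> norm (u i t) * K" .
    have "\<bar>u i t \<bullet> X' i\<bar> \<le> norm (u i t) * norm (X' i)" by (rule Cauchy_Schwarz_ineq2)
    also have "\<dots> \<le> norm (u i t) * 2" using X by (intro mult_left_mono) auto
    finally show "\<bar>u i t \<bullet> X' i\<bar> \<le> norm (u i t) * 2" .
  qed
  have tri: "norm (- a - b + c - d) \<le> norm a + norm b + norm c + norm d" for a b c d :: 'a
    using norm_triangle_ineq4[of "- a - b + c" d] norm_triangle_ineq[of "- a - b" c] norm_triangle_ineq4[of "- a" b]
    by simp
  \<comment> \<open>Here \<open>w\<close> plays the part of the bare control \<open>u i t\<close>,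
    which is the same for both states and cancels.\<close>
  have regroup: "(- a - b + c + (w - d)) - (- a' - b' + c' + (w - d'))
      = - (a - a') - (b - b') + (c - c') - (d - d')" for a b c d a' b' c' d' w :: 'a
    by simp
  have "clipped_rhs m \<gamma> \<kappa> N R u i t z - clipped_rhs m \<gamma> \<kappa> N R u i t z'
     = - ((norm V)\<^sup>2 *\<^sub>R Y - (norm V')\<^sup>2 *\<^sub>R Y') - ((\<gamma> / m) *\<^sub>R V - (\<gamma> / m) *\<^sub>R V')
      + ((\<kappa> / (m * real N)) *\<^sub>R P - (\<kappa> / (m * real N)) *\<^sub>R P')
      - ((u i t \<bullet> X i) *\<^sub>R Y - (u i t \<bullet> X' i) *\<^sub>R Y')"
    unfolding clipped_rhs_def Let_def X_def[symmetric] X'_def[symmetric] V_def[symmetric] V'_def[symmetric]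
      Y_def[symmetric] Y'_def[symmetric] P_def[symmetric] P'_def[symmetric]
    by (rule regroup)
  then have "norm (clipped_rhs m \<gamma> \<kappa> N R u i t z - clipped_rhs m \<gamma> \<kappa> N R u i t z')
     \<le> ((2 * R * K) * 8 + R\<^sup>2 * (132 * K)) + \<gamma> / m * K + 561 * (\<kappa> / m) * K
       + ((norm (u i t) * K) * 8 + (norm (u i t) * 2) * (132 * K))"
    using 1 2 4 5 tri by (smt (verit, best))
  also have "\<dots> = (16 * R + 132 * R\<^sup>2 + \<gamma> / m + 561 * (\<kappa> / m) + 272 * norm (u i t)) * K"
    by (simp add: algebra_simps)
  finally show ?thesis .
qed

text \<open>All terms without the control are continuous in time. The control term is measurable
  and, since \<open>1 + 2 * 8 = 17\<close>, dominated by \<open>17 * norm (u i t)\<close>.\<close>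

lemma clipped_rhs_absolutely_integrable:
  fixes z :: "nat \<Rightarrow> real \<Rightarrow> 'a::euclidean_space \<times> 'a"
  assumes R: "R \<ge> 0" and i: "i \<in> {1..N}" and u: "u i absolutely_integrable_on {0..T}"
    and z: "\<And>j. j \<in> {1..N} \<Longrightarrow> continuous_on {0..T} (z j)"
  shows "(\<lambda>t. clipped_rhs m \<gamma> \<kappa> N R u i t (\<lambda>j. z j t)) absolutely_integrable_on {0..T}"
proof -
  define X where "X j t = clip 2 (fst (z j t))" for j t
  define V where "V t = clip R (snd (z i t))" for t
  define Y where "Y t = clipped_inversion (X i t)" for t
  have X: "continuous_on {0..T} (X j)" if "j \<in> {1..N}" for j
    unfolding X_def using z[OF that] by (intro continuous_on_clip continuous_intros) auto
  have V: "continuous_on {0..T} V"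
    unfolding V_def using z[OF i] by (intro continuous_on_clip continuous_intros R)
  have Y: "continuous_on {0..T} Y"
    unfolding Y_def by (intro continuous_on_clipped_inversion X i)
  have "continuous_on {0..T} (\<lambda>t. - ((norm (V t))\<^sup>2 *\<^sub>R Y t) - (\<gamma> / m) *\<^sub>R V t
        + (\<kappa> / (m * real N)) *\<^sub>R (\<Sum>j\<in>{1..N}. X j t - (X i t \<bullet> X j t) *\<^sub>R Y t))"
    by (intro continuous_intros X V Y i)
  then have 1: "(\<lambda>t. - ((norm (V t))\<^sup>2 *\<^sub>R Y t) - (\<gamma> / m) *\<^sub>R V t
        + (\<kappa> / (m * real N)) *\<^sub>R (\<Sum>j\<in>{1..N}. X j t - (X i t \<bullet> X j t) *\<^sub>R Y t)) absolutely_integrable_on {0..T}"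
    by (rule absolutely_integrable_continuous_real)
  have 2: "(\<lambda>t. u i t - (u i t \<bullet> X i t) *\<^sub>R Y t) absolutely_integrable_on {0..T}"
  proof (rule measurable_bounded_by_integrable_imp_absolutely_integrable)
    have [measurable]: "u i \<in> borel_measurable (lebesgue_on {0..T})"
      using u set_lebesgue_integral_eq_integral(1) integrable_imp_measurable by blast
    have [measurable]: "X i \<in> borel_measurable (lebesgue_on {0..T})" "Y \<in> borel_measurable (lebesgue_on {0..T})"
      using X[OF i] Y by (auto intro!: continuous_imp_measurable_on_sets_lebesgue)
    show "(\<lambda>t. u i t - (u i t \<bullet> X i t) *\<^sub>R Y t) \<in> borel_measurable (lebesgue_on {0..T})"
      by measurable
    show "(\<lambda>t. 17 * norm (u i t)) integrable_on {0..T}"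
      using u by (intro integrable_on_mult_right) (simp add: absolutely_integrable_on_def)
    fix t
    have XY: "norm (X i t) \<le> 2" "norm (Y t) \<le> 8"
      by (simp_all add: X_def Y_def norm_clip_le norm_clipped_inversion_le)
    have "\<bar>u i t \<bullet> X i t\<bar> * norm (Y t) \<le> (norm (u i t) * 2) * 8"
      using XY order_trans[OF Cauchy_Schwarz_ineq2 mult_left_mono[OF XY(1) norm_ge_zero]]
      by (intro mult_mono) auto
    then show "norm (u i t - (u i t \<bullet> X i t) *\<^sub>R Y t) \<le> 17 * norm (u i t)"
      using norm_triangle_ineq4[of "u i t" "(u i t \<bullet> X i t) *\<^sub>R Y t"] by simp
  qed auto
  show ?thesis
    using set_integral_add(1)[OF 1 2] unfolding clipped_rhs_def Let_def X_def V_def Y_def .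
qed

section \<open>Global well-posedness\<close>

theorem theorem2p1:
  fixes N :: nat and m \<gamma> \<kappa> T :: real
    and u :: "nat \<Rightarrow> real \<Rightarrow> 'a::euclidean_space"
    and x0 v0 :: "nat \<Rightarrow> 'a"
  assumes "N \<ge> 1" and "DIM('a) \<ge> 2" and "m > 0" and "\<gamma> > 0" and "\<kappa> \<ge> 0" and "T > 0"
    and u_meas: "\<And>i. i \<in> {1..N} \<Longrightarrow> set_borel_measurable lborel {0..T} (u i)"
    and u_L2: "\<And>i. i \<in> {1..N} \<Longrightarrow> set_integrable lborel {0..T} (\<lambda>t. (norm (u i t))\<^sup>2)"
    and x0_sphere: "\<And>i. i \<in> {1..N} \<Longrightarrow> norm (x0 i) = 1"
    and v0_tangent: "\<And>i. i \<in> {1..N} \<Longrightarrow> x0 i \<bullet> v0 i = 0"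
    and small: "let M = Max ((\<lambda>i. L2_norm_on T (u i)) ` {1..N});
                    V0 = Max ((\<lambda>i. norm (v0 i)) ` {1..N});
                    A = V0 + 2 * \<kappa> * T / m + 2 * M * sqrt T
                in (m / \<gamma>) * A * (exp (\<gamma> * T / m) - 1) < 1"
  shows "\<exists>x v. is_solution m \<gamma> \<kappa> N T u x0 v0 x v \<and>
           (\<forall>x' v'. is_solution m \<gamma> \<kappa> N T u x0 v0 x' v' \<longrightarrow>
              (\<forall>i\<in>{1..N}. \<forall>t\<in>{0..T}. x' i t = x i t \<and> v' i t = v i t)) \<and>
           (\<forall>i\<in>{1..N}. \<forall>t\<in>{0..T}. norm (x i t) = 1 \<and> x i t \<bullet> v i t = 0) \<and>
           (let M = Max ((\<lambda>i. L2_norm_on T (u i)) ` {1..N});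
                V0 = Max ((\<lambda>i. norm (v0 i)) ` {1..N});
                A = V0 + 2 * \<kappa> * T / m + 2 * M * sqrt T;
                CV = exp (\<gamma> * T / m) * A / (1 - (m / \<gamma>) * A * (exp (\<gamma> * T / m) - 1))
            in \<forall>t\<in>{0..T}. Max ((\<lambda>i. norm (v i t)) ` {1..N}) \<le> CV)"
proof -
  define M where "M = Max ((\<lambda>i. L2_norm_on T (u i)) ` {1..N})"
  define V0 where "V0 = Max ((\<lambda>i. norm (v0 i)) ` {1..N})"
  define A where "A = V0 + 2 * \<kappa> * T / m + 2 * M * sqrt T"
  define CV where "CV = exp (\<gamma> * T / m) * A / (1 - (m / \<gamma>) * A * (exp (\<gamma> * T / m) - 1))"
  have M: "L2_norm_on T (u i) \<le> M" and V0: "norm (v0 i) \<le> V0" if "i \<in> {1..N}" for i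
    using that by (auto simp: M_def V0_def)
  have u_abs: "u i absolutely_integrable_on {0..T}" if "i \<in> {1..N}" for i
    using L2_imp_absolutely_integrable[OF u_meas u_L2] that by blast
  have u_norm: "(\<lambda>t. norm (u i t)) integrable_on {0..T}" if "i \<in> {1..N}" for i
    using u_abs[OF that] by (simp add: absolutely_integrable_on_def)
  have one: "1 \<in> {1..N}" using \<open>N \<ge> 1\<close> by simp
  have "0 \<le> L2_norm_on T (u 1)"
    using u_L2[OF one] by (auto simp: L2_norm_on_def set_lebesgue_integral_def intro!: integral_nonneg_AE)
  then have "0 \<le> M" using M[OF one] by linarith
  moreover have "0 \<le> V0" using V0[OF one] norm_ge_zero order_trans by blast
  ultimately have A: "0 \<le> A" using assms by (simp add: A_def)

  \<comment> \<open>Formulated on every shorter interval \<open>[0, \<tau>]\<close> with the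
    constant belonging to \<open>T\<close>, so that it also applies before the first time at which
    the truncation could become active.\<close>
  have bound: "norm (v i t) \<le> A"
    if sol: "is_solution m \<gamma> \<kappa> N \<tau> u x0 v0 x v" and \<tau>: "\<tau> \<le> T" and i: "i \<in> {1..N}" and t: "t \<in> {0..\<tau>}"
    for \<tau> x v i t
  proof -
    have uT: "(\<lambda>t. norm (u i t)) integrable_on {0..\<tau>}"
      using integrable_subinterval_real[OF u_norm[OF i], of 0 \<tau>] \<tau> by auto
    have "norm (v i t) \<le> norm (v0 i) + 2 * \<kappa> * \<tau> / m + 2 * integral {0..\<tau>} (\<lambda>t. norm (u i t))"
      using assms i t uT by (intro solution_velocity_bound[OF sol]) auto
    moreover have "integral {0..\<tau>} (\<lambda>t. norm (u i t)) \<le> integral {0..T} (\<lambda>t. norm (u i t))"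
      using \<tau> by (intro integral_subset_le uT u_norm i) auto
    moreover have "integral {0..T} (\<lambda>t. norm (u i t)) \<le> sqrt T * L2_norm_on T (u i)"
      by (rule integral_norm_le_L2_norm_on[OF \<open>T > 0\<close> u_meas[OF i] u_L2[OF i]])
    moreover have "sqrt T * L2_norm_on T (u i) \<le> M * sqrt T"
      using M[OF i] \<open>T > 0\<close> by (simp add: mult.commute)
    moreover have "2 * \<kappa> * \<tau> / m \<le> 2 * \<kappa> * T / m"
      using assms \<tau> by (intro divide_right_mono mult_left_mono) auto
    moreover have "norm (v0 i) \<le> V0" by (rule V0[OF i])
    ultimately show ?thesis unfolding A_def by linarith
  qed

  \<comment> \<open>Strictly above the a priori bound \<open>A\<close>, which leaves room for the
    continuity argument at a first bad time.\<close>
  define R where "R = A + 1"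
  have R: "R \<ge> 0" "A < R" using A by (auto simp: R_def)
  \<comment> \<open>The leading 1 is the Lipschitz constant of the position equation, the rest comes
    from \<open>norm_clipped_rhs_diff_le\<close>. Summing all controls in \<open>L\<close> gives one
    function that serves every particle.\<close>
  define C where "C = 1 + 16 * R + 132 * R\<^sup>2 + \<gamma> / m + 561 * (\<kappa> / m)"
  have C: "C \<ge> 0" using R assms by (simp add: C_def)
  define L where "L t = C + 272 * (\<Sum>j\<in>{1..N}. norm (u j t))" for t
  define F where "F i t z = (snd (z i), clipped_rhs m \<gamma> \<kappa> N R u i t z)" for i t and z :: "nat \<Rightarrow> 'a \<times> 'a"
  have L_int: "L absolutely_integrable_on {0..T}"
    unfolding L_def
    by (intro set_integral_add(1) absolutely_integrable_continuous_real continuous_intros set_integrable_mult_right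
        absolutely_integrable_sum absolutely_integrable_norm[unfolded o_def] u_abs) auto
  have L_pos: "0 \<le> L t" for t using C by (simp add: L_def sum_nonneg)
  have clipped_int: "(\<lambda>t. clipped_rhs m \<gamma> \<kappa> N R u i t (\<lambda>j. z j t)) absolutely_integrable_on {0..T}"
    if "\<And>j. j \<in> {1..N} \<Longrightarrow> continuous_on {0..T} (z j)" "i \<in> {1..N}" for z i
    using that by (intro clipped_rhs_absolutely_integrable R u_abs)
  obtain z where zcont: "\<And>i. i \<in> {1..N} \<Longrightarrow> continuous_on {0..T} (z i)"
    and zint: "\<And>i t. \<lbrakk>i \<in> {1..N}; t \<in> {0..T}\<rbrakk> \<Longrightarrow> ((\<lambda>s. F i s (\<lambda>j. z j s)) has_integral (z i t - (x0 i, v0 i))) {0..t}"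
    and zunique: "\<And>z' i t. \<lbrakk>\<And>i. i \<in> {1..N} \<Longrightarrow> continuous_on {0..T} (z' i);
       \<And>i t. \<lbrakk>i \<in> {1..N}; t \<in> {0..T}\<rbrakk> \<Longrightarrow> ((\<lambda>s. F i s (\<lambda>j. z' j s)) has_integral (z' i t - (x0 i, v0 i))) {0..t};
       i \<in> {1..N}; t \<in> {0..T}\<rbrakk> \<Longrightarrow> z' i t = z i t"
  proof (rule caratheodory_integral_equation[of "{1..N}" T L F "\<lambda>i. (x0 i, v0 i)"])
    show "(\<lambda>t. F i t (\<lambda>j. z j t)) integrable_on {0..T}"
      if z: "\<And>j. j \<in> {1..N} \<Longrightarrow> continuous_on {0..T} (z j)" and i: "i \<in> {1..N}" for z i
    proof -
      have "(\<lambda>t. snd (z i t)) integrable_on {0..T}"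
        using z[OF i] by (intro integrable_continuous_real continuous_intros)
      moreover have "(\<lambda>t. clipped_rhs m \<gamma> \<kappa> N R u i t (\<lambda>j. z j t)) integrable_on {0..T}"
        by (intro set_lebesgue_integral_eq_integral(1) clipped_int z i)
      \<comment> \<open>The pair is split into its two embedded components, each of which is
        integrable as the image of an integrable function under a bounded linear map.\<close>
      ultimately have "(\<lambda>t. (snd (z i t), 0) + (0, clipped_rhs m \<gamma> \<kappa> N R u i t (\<lambda>j. z j t))) integrable_on {0..T}"
        using integrable_linear[OF _ bounded_linear_Pair[OF bounded_linear_ident bounded_linear_zero]]
          integrable_linear[OF _ bounded_linear_Pair[OF bounded_linear_zero bounded_linear_ident]]
        by (intro integrable_add) (auto simp: o_def)
      then show ?thesis by (simp add: F_def)
    qed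
    show "norm (F i t y - F i t y') \<le> L t * K"
      if i: "i \<in> {1..N}" and "t \<in> {0..T}" and y: "\<And>j. j \<in> {1..N} \<Longrightarrow> norm (y j - y' j) \<le> K" for i t y y' K
    proof -
      have K: "K \<ge> 0" using y[OF i] norm_ge_zero order_trans by blast
      have "norm (F i t y - F i t y') \<le> norm (snd (y i) - snd (y' i))
          + norm (clipped_rhs m \<gamma> \<kappa> N R u i t y - clipped_rhs m \<gamma> \<kappa> N R u i t y')"
        unfolding F_def by (simp add: norm_Pair_le)
      moreover have "norm (snd (y i) - snd (y' i)) \<le> K"
        using norm_snd_le[of "snd (y i - y' i)" "fst (y i - y' i)", unfolded prod.collapse] y[OF i] by simp
      moreover have "norm (clipped_rhs m \<gamma> \<kappa> N R u i t y - clipped_rhs m \<gamma> \<kappa> N R u i t y')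
         \<le> (16 * R + 132 * R\<^sup>2 + \<gamma> / m + 561 * (\<kappa> / m) + 272 * norm (u i t)) * K"
        using assms R i y by (intro norm_clipped_rhs_diff_le) auto
      ultimately have "norm (F i t y - F i t y') \<le> (C + 272 * norm (u i t)) * K"
        by (simp add: C_def distrib_right)
      also have "\<dots> \<le> L t * K"
        unfolding L_def using i K by (intro mult_right_mono add_left_mono mult_left_mono member_le_sum) auto
      finally show ?thesis .
    qed
  qed (use \<open>T > 0\<close> L_int L_pos in auto)

  define x where "x i t = fst (z i t)" for i t
  define v where "v i t = snd (z i t)" for i t
  have z_eq: "(\<lambda>j. z j t) = (\<lambda>j. (x j t, v j t))" for t by (simp add: x_def v_def)
  have xcont: "continuous_on {0..T} (x i)" and vcont: "continuous_on {0..T} (v i)" if "i \<in> {1..N}" for i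
    unfolding x_def v_def using zcont[OF that] by (intro continuous_intros; assumption)+
  have x_int: "(v i has_integral (x i t - x0 i)) {0..t}"
    and v_int: "((\<lambda>s. clipped_rhs m \<gamma> \<kappa> N R u i s (\<lambda>j. z j s)) has_integral (v i t - v0 i)) {0..t}"
    if "i \<in> {1..N}" "t \<in> {0..T}" for i t
    using has_integral_linear[OF zint[OF that] bounded_linear_fst] has_integral_linear[OF zint[OF that] bounded_linear_snd]
    by (simp_all add: F_def o_def x_def v_def[abs_def])
  have x_sol: "abs_continuous_on 0 T (x i)" "x i 0 = x0 i"
      "AE t in lborel. t \<in> {0..T} \<longrightarrow> (x i has_vector_derivative v i t) (at t)" if i: "i \<in> {1..N}" for i
  proof -
    have v_abs: "v i absolutely_integrable_on {0..T}"
      by (intro absolutely_integrable_continuous_real vcont i)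
    show "abs_continuous_on 0 T (x i)" "x i 0 = x0 i"
      "AE t in lborel. t \<in> {0..T} \<longrightarrow> (x i has_vector_derivative v i t) (at t)"
      using integral_equation_imp_solution[OF v_abs, of "x i" "x0 i"] x_int[OF i] \<open>T > 0\<close> by auto
  qed
  have v_sol: "abs_continuous_on 0 T (v i)" "v i 0 = v0 i"
      "AE t in lborel. t \<in> {0..T} \<longrightarrow>
        (v i has_vector_derivative clipped_rhs m \<gamma> \<kappa> N R u i t (\<lambda>j. z j t)) (at t)" if i: "i \<in> {1..N}" for i
  proof -
    have rhs_abs: "(\<lambda>t. clipped_rhs m \<gamma> \<kappa> N R u i t (\<lambda>j. z j t)) absolutely_integrable_on {0..T}"
      by (intro clipped_int zcont i)
    show "abs_continuous_on 0 T (v i)" "v i 0 = v0 i"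
      "AE t in lborel. t \<in> {0..T} \<longrightarrow>
        (v i has_vector_derivative clipped_rhs m \<gamma> \<kappa> N R u i t (\<lambda>j. z j t)) (at t)"
      using integral_equation_imp_solution[OF rhs_abs, of "v i" "v0 i"] v_int[OF i] \<open>T > 0\<close> by auto
  qed

  \<comment> \<open>While these strict bounds hold, the truncated and the original right-hand sides
    agree. Leaving \<open>\<tau>\<close> free allows the use on intervals that end before a possible
    violation.\<close>
  have sol: "is_solution m \<gamma> \<kappa> N \<tau> u x0 v0 x v"
    if \<tau>: "\<tau> \<le> T" and good: "\<And>i s. \<lbrakk>i \<in> {1..N}; s \<in> {0..\<tau>}\<rbrakk> \<Longrightarrow> 1 / 2 < norm (x i s) \<and> norm (x i s) < 2 \<and> norm (v i s) < R"
    for \<tau>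
    unfolding is_solution_def
  proof (intro ballI conjI)
    fix i assume i: "i \<in> {1..N}"
    show "abs_continuous_on 0 \<tau> (x i)" "abs_continuous_on 0 \<tau> (v i)"
      using abs_continuous_on_subinterval[OF x_sol(1)[OF i] order_refl \<tau>]
        abs_continuous_on_subinterval[OF v_sol(1)[OF i] order_refl \<tau>] by auto
    show "x i 0 = x0 i" "v i 0 = v0 i" using x_sol(2)[OF i] v_sol(2)[OF i] by auto
    show "x i t \<noteq> 0" if "t \<in> {0..\<tau>}" for t using good[OF i that] by auto
    show "AE t in lborel. t \<in> {0..\<tau>} \<longrightarrow> (x i has_vector_derivative v i t) (at t) \<and>
        (v i has_vector_derivative vel_rhs m \<gamma> \<kappa> N u x v i t) (at t)"
      using x_sol(3)[OF i] v_sol(3)[OF i]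
    proof eventually_elim
      case (elim t)
      have "clipped_rhs m \<gamma> \<kappa> N R u i t (\<lambda>j. z j t) = vel_rhs m \<gamma> \<kappa> N u x v i t" if "t \<in> {0..\<tau>}"
        unfolding z_eq using good[OF _ that] i by (intro clipped_rhs_eq_vel_rhs) (auto intro: less_imp_le)
      then show ?case using elim \<tau> by auto
    qed
  qed

  have good: "1 / 2 < norm (x i s) \<and> norm (x i s) < 2 \<and> norm (v i s) < R" if "i \<in> {1..N}" "s \<in> {0..T}" for i s
  proof (rule ccontr)
    assume bad_is: "\<not> ?thesis"
    \<comment> \<open>Up to the first bad time the truncation is inactive, so the a priori bounds apply there, and
      by continuity they contradict badness at that time.\<close>
    define Bad where "Bad = (\<Union>i\<in>{1..N}. {s \<in> {0..T}. norm (x i s) \<le> 1 / 2} \<union> {s \<in> {0..T}. 2 \<le> norm (x i s)} \<union> {s \<in> {0..T}. R \<le> norm (v i s)})"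
    have closed: "closed {s \<in> {0..T}. norm (x i s) \<le> 1 / 2}" "closed {s \<in> {0..T}. 2 \<le> norm (x i s)}" "closed {s \<in> {0..T}. R \<le> norm (v i s)}"
      if "i \<in> {1..N}" for i
      using xcont[OF that] vcont[OF that]
      by (intro continuous_on_closed_Collect_le continuous_intros closed_atLeastAtMost; simp)+
    have "closed Bad" unfolding Bad_def by (intro closed_UN closed_Un ballI closed finite_atLeastAtMost)
    moreover have "bounded Bad" by (rule bounded_subset[OF bounded_closed_interval[of 0 T]]) (auto simp: Bad_def)
    ultimately have "compact Bad" by (simp add: compact_eq_bounded_closed)
    moreover have "s \<in> Bad"
      unfolding Bad_def UN_iff using that bad_is by (intro bexI[of _ i]) (auto simp: not_less)
    \<comment> \<open>\<open>Bad\<close> is defined by non-strict inequalities, hence compact, so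
      there is a first bad time.\<close>
    ultimately obtain t where t: "t \<in> Bad" and t_min: "\<And>s. s \<in> Bad \<Longrightarrow> t \<le> s"
      using compact_attains_inf[of Bad] by blast
    obtain k where k: "k \<in> {1..N}" and t0T: "t \<in> {0..T}"
      and bad_k: "norm (x k t) \<le> 1 / 2 \<or> 2 \<le> norm (x k t) \<or> R \<le> norm (v k t)"
      using t by (auto simp: Bad_def)
    \<comment> \<open>The initial data satisfy all three bounds strictly, so the first bad time is
      positive.\<close>
    have "norm (v0 k) \<le> A" using V0[OF k] \<open>0 \<le> M\<close> assms unfolding A_def by (simp add: add_increasing2)
    then have "t \<noteq> 0" using bad_k x_sol(2)[OF k] v_sol(2)[OF k] x0_sphere[OF k] k R(2) by auto
    then have t_pos: "0 < t" using t0T by auto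
    \<comment> \<open>For \<open>s < t\<close> the interval \<open>[0, s]\<close> contains no bad
      time, so the fixed point solves the original system there and obeys the a priori
      bounds.\<close>
    have before: "norm (x k s) = 1" "norm (v k s) \<le> A" if "s \<in> {0..<t}" for s
    proof -
      have s_sol: "is_solution m \<gamma> \<kappa> N s u x0 v0 x v"
      proof (rule sol)
        show "s \<le> T" using that t0T by auto
        fix i r assume ir: "i \<in> {1..N}" "r \<in> {0..s}"
        then have "r \<notin> Bad" using t_min[of r] that by auto
        moreover have "r \<in> {0..T}" using ir that t0T by auto
        ultimately show "1 / 2 < norm (x i r) \<and> norm (x i r) < 2 \<and> norm (v i r) < R"
          using ir(1) unfolding Bad_def UN_iff by (auto simp: not_le dest!: bspec[of _ _ i])
      qed
      have s: "s \<in> {0..s}" "s \<le> T" using that t0T by auto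
      show "norm (x k s) = 1"
        by (rule solution_sphere_tangent(1)[OF s_sol \<open>m > 0\<close> \<open>\<gamma> > 0\<close>]; fact x0_sphere[OF k] v0_tangent[OF k] k s)
      show "norm (v k s) \<le> A" by (rule bound[OF s_sol s(2) k s(1)])
    qed
    \<comment> \<open>Continuity carries the unit norm and the bound \<open>A\<close> from
      \<open>[0, t)\<close> to \<open>t\<close> itself, where they contradict
      \<open>bad_k\<close>.\<close>
    have closure: "closure {0..<t} = {0..t}" using t_pos by (simp add: closure_atLeastLessThan)
    have sub: "{0..t} \<subseteq> {0..T}" using t0T by auto
    have "norm (x k t) = 1"
      by (rule continuous_constant_on_closure[of "{0..<t}" "\<lambda>s. norm (x k s)"])
        (use before t_pos continuous_on_subset[OF xcont[OF k] sub] in \<open>auto simp: closure intro!: continuous_intros\<close>)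
    moreover have "norm (v k t) \<le> A"
      by (rule continuous_le_on_closure[of "{0..<t}" "\<lambda>s. norm (v k s)"])
        (use before t_pos continuous_on_subset[OF vcont[OF k] sub] in \<open>auto simp: closure intro!: continuous_intros\<close>)
    ultimately show False using bad_k R(2) by auto
  qed
  have solT: "is_solution m \<gamma> \<kappa> N T u x0 v0 x v" using good by (intro sol) auto

  \<comment> \<open>Any solution of the original system obeys the a priori bounds, hence solves the
    truncated integral equation, whose continuous solution is unique.\<close>
  have unique: "x' i t = x i t \<and> v' i t = v i t"
    if sol': "is_solution m \<gamma> \<kappa> N T u x0 v0 x' v'" and i: "i \<in> {1..N}" and t: "t \<in> {0..T}" for x' v' i t
  proof -
    have sphere: "norm (x' j s) = 1" if "j \<in> {1..N}" "s \<in> {0..T}" for j s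
      using solution_sphere_tangent(1)[OF sol' \<open>m > 0\<close> \<open>\<gamma> > 0\<close>, of j s] x0_sphere v0_tangent that by blast
    have vel: "norm (v' j s) \<le> A" if "j \<in> {1..N}" "s \<in> {0..T}" for j s
      using bound[OF sol' order_refl, of j s] that by blast
    have ac: "abs_continuous_on 0 T (x' j)" "abs_continuous_on 0 T (v' j)" "x' j 0 = x0 j" "v' j 0 = v0 j"
      and ode: "AE t in lborel. t \<in> {0..T} \<longrightarrow>
            (x' j has_vector_derivative v' j t) (at t) \<and>
            (v' j has_vector_derivative vel_rhs m \<gamma> \<kappa> N u x' v' j t) (at t)" if "j \<in> {1..N}" for j
      using sol' that unfolding is_solution_def by blast+
    have "(\<lambda>j s. (x' j s, v' j s)) i t = z i t"
    proof (rule zunique[OF _ _ i t])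
      fix j assume j: "j \<in> {1..N}"
      have pair_ac: "abs_continuous_on 0 T (\<lambda>s. (x' j s, v' j s))"
        by (rule abs_continuous_on_dominated[OF ac(1,2)[OF j], where C = 1]) (simp add: norm_Pair_le)
      then show "continuous_on {0..T} (\<lambda>s. (x' j s, v' j s))"
        by (rule abs_continuous_on_imp_continuous_on)
      fix r assume r: "r \<in> {0..T}"
      have "((\<lambda>s. F j s (\<lambda>j. (x' j s, v' j s))) has_integral ((x' j r, v' j r) - (x' j 0, v' j 0))) {0..r}"
      proof (rule abs_continuous_on_has_integral)
        show "abs_continuous_on 0 r (\<lambda>s. (x' j s, v' j s))"
          using r by (intro abs_continuous_on_subinterval[OF pair_ac]) auto
        show "AE s in lborel. s \<in> {0..r} \<longrightarrow> ((\<lambda>s. (x' j s, v' j s)) has_vector_derivative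
            F j s (\<lambda>j. (x' j s, v' j s))) (at s within {0..r})"
          using ode[OF j]
        proof eventually_elim
          case (elim s)
          show ?case
          proof
            assume "s \<in> {0..r}"
            then have s: "s \<in> {0..T}" using r by auto
            have "clipped_rhs m \<gamma> \<kappa> N R u j s (\<lambda>j. (x' j s, v' j s)) = vel_rhs m \<gamma> \<kappa> N u x' v' j s"
              by (rule clipped_rhs_eq_vel_rhs) (use sphere[OF _ s] vel[OF j s] R(2) j in auto)
            then show "((\<lambda>s. (x' j s, v' j s)) has_vector_derivative F j s (\<lambda>j. (x' j s, v' j s))) (at s within {0..r})"
              using elim s unfolding F_def
              by (simp add: has_vector_derivative_Pair has_vector_derivative_at_within)
          qed
        qed
      qed (use r in auto)
      then show "((\<lambda>s. F j s (\<lambda>j. (x' j s, v' j s))) has_integral ((x' j r, v' j r) - (x0 j, v0 j))) {0..r}"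
        by (simp add: ac[OF j])
    qed
    then show ?thesis by (simp add: x_def v_def prod_eq_iff)
  qed

  \<comment> \<open>The smallness assumption makes the denominator \<open>D\<close> of
    \<open>CV\<close> positive. Since also \<open>D \<le> 1 \<le> exp (\<gamma> * T / m)\<close>,
    the quotient multiplies \<open>A\<close> by at least 1.\<close>
  have "A \<le> CV"
  proof -
    define D where "D = 1 - (m / \<gamma>) * A * (exp (\<gamma> * T / m) - 1)"
    have "0 < D" using small by (simp add: D_def A_def M_def V0_def Let_def)
    moreover have e: "1 \<le> exp (\<gamma> * T / m)" using assms by simp
    then have "0 \<le> (m / \<gamma>) * A * (exp (\<gamma> * T / m) - 1)" using A assms by simp
    then have "D \<le> exp (\<gamma> * T / m)" using e unfolding D_def by linarith
    then have "A * D \<le> exp (\<gamma> * T / m) * A" using A by (simp add: mult.commute mult_left_mono)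
    ultimately show ?thesis unfolding CV_def D_def[symmetric] by (simp add: pos_le_divide_eq)
  qed
  then have "norm (v i t) \<le> CV" if "i \<in> {1..N}" "t \<in> {0..T}" for i t
    using bound[OF solT order_refl that] by linarith
  then have "\<forall>t\<in>{0..T}. Max ((\<lambda>i. norm (v i t)) ` {1..N}) \<le> CV"
    using \<open>N \<ge> 1\<close> by simp
  then have "let M = Max ((\<lambda>i. L2_norm_on T (u i)) ` {1..N});
                V0 = Max ((\<lambda>i. norm (v0 i)) ` {1..N});
                A = V0 + 2 * \<kappa> * T / m + 2 * M * sqrt T;
                CV = exp (\<gamma> * T / m) * A / (1 - (m / \<gamma>) * A * (exp (\<gamma> * T / m) - 1))
            in \<forall>t\<in>{0..T}. Max ((\<lambda>i. norm (v i t)) ` {1..N}) \<le> CV"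
    by (simp only: Let_def CV_def A_def M_def V0_def)
  moreover have "norm (x i t) = 1 \<and> x i t \<bullet> v i t = 0" if "i \<in> {1..N}" "t \<in> {0..T}" for i t
    using solution_sphere_tangent[OF solT \<open>m > 0\<close> \<open>\<gamma> > 0\<close>, of i t] x0_sphere v0_tangent that by blast
  ultimately show ?thesis using solT unique by (intro exI[of _ x] exI[of _ v]) blast
qed

end
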